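(* Let $\sigma_C^2,\sigma_E^2$ be real numbers with $0\le\sigma_E^2<\sigma_C^2$. Suppose that, as $n\to\infty$, $$\sqrt{n}\begin{pmatrix}\widehat{\beta}_C-\beta_0\\ \widehat{\beta}_E-\beta_E\end{pmatrix}\xrightarrow{d}\mathcal{N}\left(0,\begin{pmatrix}\sigma_C^2&\sigma_E^2\\ \sigma_E^2&\sigma_E^2\end{pmatrix}\right),$$ and $n\widehat{V}(\widehat{\beta}_C)\xrightarrow{p}\sigma_C^2$, $n\widehat{V}(\widehat{\beta}_E)\xrightarrow{p}\sigma_E^2$, $n\widehat{\mathrm{cov}}(\widehat{\beta}_C,\widehat{\beta}_E)\xrightarrow{p}\sigma_E^2$. Let $\widehat{\beta}_{MSE}$ be the empirical-MSE-minimizing estimator (defined in the context). Then: 1. If $\beta_0\neq\beta_E$ and $\beta_0$ and $\beta_E$ do not depend on $n$, then $\sqrt{n}(\widehat{\beta}_{MSE}-\beta_0)\xrightarrow{d}\mathcal{N}(0,\sigma_C^2)$. 2. If $\beta_0=\beta_E$, then $\sqrt{n}(\widehat{\beta}_{MSE}-\beta_0)\xrightarrow{d}U_0$, where $U_0$ is a random variable such that $E(U_0)=0$ and $V(U_0)\in(\sigma_E^2,\sigma_C^2)$. 3. There is a family of random variables $(U_h)_{h\in\mathbb{R}}$ such that, for every $h\in\mathbb{R}$, if $\beta_E=\beta_0+h/\sqrt{n}$ then $\sqrt{n}(\widehat{\beta}_{MSE}-\beta_0)\xrightarrow{d}U_h$, and this family satisfies $$\max_{h\in\mathbb{R}}\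left[E(U_h^2)-\sigma_C^2\right]<\max_{h\in\mathbb{R}}\left[\sigma_C^2-E(U_h^2)\right].$$
   Context: For each sample size $n$, $\widehat{\beta}_C$ and $\widehat{\beta}_E$ are real-valued random variables (estimators; the dependence on $n$ is suppressed), and $\beta_0,\beta_E\in\mathbb{R}$ are parameters, which may depend on $n$ unless stated otherwise (in Part 3, $\beta_E=\beta_0+h/\sqrt n$ does). $\widehat{V}(\widehat{\beta}_C)$, $\widehat{V}(\widehat{\beta}_E)$ and $\widehat{\mathrm{cov}}(\widehat{\beta}_C,\widehat{\beta}_E)$ are real-valued random variables (estimators of the variances of $\widehat{\beta}_C$, $\widehat{\beta}_E$ and of their covariance). In Part 3 the stated hypotheses are assumed to hold, with the same $\sigma_C^2,\sigma_E^2$, along the sequence with $\beta_E=\beta_0+h/\sqrt{n}$, for each $h$. The empirical-MSE-minimizing estimator is $\widehat{\beta}_{MSE}=\widehat{p}\,\widehat{\beta}_E+(1-\widehat{p})\,\widehat{\beta}_C$, where $$\widehat{p}=\arg\min_{p\in\mathbb{R}}\; p^2(\widehat{\beta}_E-\widehat{\beta}_C)^2+p^2\widehat{V}(\widehat{\beta}_E)+(1-p)^2\widehat{V}(\widehat{\beta}_C)+2p(1-p)\widehat{\mathrm{cov}}(\widehat{\beta}_C,\widehat{\beta}_E),$$ that is, $$\widehat{p}=\frac{\widehat{V}(\widehat{\beta}_C)-\widehat{\mathrm{cov}}(\widehat{\beta}_C,\widehat{\beta}_E)}{(\widehat{\beta}_E-\widehat{\beta}_C)^2+\widehat{V}(\widehat{\beta}_E-\widehat{\beta}_C)},\qquad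 \widehat{V}(\widehat{\beta}_E-\widehat{\beta}_C)=\widehat{V}(\widehat{\beta}_E)+\widehat{V}(\widehat{\beta}_C)-2\widehat{\mathrm{cov}}(\widehat{\beta}_C,\widehat{\beta}_E).$$ (The denominator is positive with probability tending to one; the value of $\widehat{p}$ elsewhere is immaterial.) $V(U)$ denotes the variance of $U$; $\xrightarrow{d}$ and $\xrightarrow{p}$ denote convergence in distribution and in probability. *)

theory Defs
  imports "HOL-Probability.Probability"
begin

section \<open>Modes of convergence\<close>

text \<open>
  The library's \<^const>\<open>weak_conv_m\<close> only covers laws on the real line, so the convergence of
  the vector of estimators is stated in the usual bounded-continuous form. As in
  \<^const>\<open>weak_conv_m\<close>, each member of the sequence may live on its own probability space.
\<close>

definition conv_in_distr ::
  "(nat \<Rightarrow> 'a measure) \<Rightarrow> (nat \<Rightarrow> 'a \<Rightarrow> 'b::metric_space) \<Rightarrow> 'b measure \<Rightarrow> bool" where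
  "conv_in_distr M X N \<longleftrightarrow>
     (\<forall>f :: 'b \<Rightarrow> real. continuous_on UNIV f \<longrightarrow> bounded (range f) \<longrightarrow>
        (\<lambda>n. \<integral>\<omega>. f (X n \<omega>) \<partial>M n) \<longlonglongrightarrow> (\<integral>x. f x \<partial>N))"

definition conv_in_prob ::
  "(nat \<Rightarrow> 'a measure) \<Rightarrow> (nat \<Rightarrow> 'a \<Rightarrow> 'b::metric_space) \<Rightarrow> 'b \<Rightarrow> bool" where
  "conv_in_prob M X c \<longleftrightarrow>
     (\<forall>e>0. (\<lambda>n. measure (M n) {\<omega> \<in> space (M n). dist (X n \<omega>) c > e}) \<longlonglongrightarrow> 0)"

section \<open>Multivariate normal laws\<close>

text \<open>
  \<open>N\<close> is the normal law with mean \<open>m\<close> and covariance matrix \<open>S\<close>. It is specified by its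
  characteristic function, because \<open>S\<close> may be singular, in which case \<open>N\<close> has no density.
\<close>

definition normal_law :: "real^'n \<Rightarrow> real^'n^'n \<Rightarrow> (real^'n) measure \<Rightarrow> bool" where
  "normal_law m S N \<longleftrightarrow>
     prob_space N \<and> sets N = sets borel \<and>
     (\<forall>t. (\<integral>x. cis (t \<bullet> x) \<partial>N) = cis (t \<bullet> m) * exp (- complex_of_real (t \<bullet> (S *v t)) / 2))"

section \<open>The empirical-MSE-minimizing estimator\<close>

text \<open>
  Arguments: \<open>bC\<close>, \<open>bE\<close> are the values of the two estimators, \<open>vC\<close>, \<open>vE\<close> their estimated
  variances and \<open>cCE\<close> their estimated covariance.
\<close>

definition emp_mse :: "real \<Rightarrow> real \<Rightarrow> real \<Rightarrow> real \<Rightarrow> real \<Rightarrow> real \<Rightarrow> real" where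
  "emp_mse bC bE vC vE cCE p =
     p\<^sup>2 * (bE - bC)\<^sup>2 + p\<^sup>2 * vE + (1 - p)\<^sup>2 * vC + 2 * p * (1 - p) * cCE"

text \<open>
  If the denominator in \<open>p_hat_eq\<close> below is not positive, the minimizer may fail to exist or to be
  unique; \<^const>\<open>arg_min\<close> then returns a fixed but unspecified real number, the same at all such
  sample points without a minimizer (and likewise where every \<open>p\<close> is a minimizer).
\<close>

definition p_hat :: "real \<Rightarrow> real \<Rightarrow> real \<Rightarrow> real \<Rightarrow> real \<Rightarrow> real" where
  "p_hat bC bE vC vE cCE = (ARG_MIN (emp_mse bC bE vC vE cCE) p. True)"

lemma p_hat_eq:
  assumes D: "(bE - bC)\<^sup>2 + (vE + vC - 2 * cCE) > 0"
  shows "p_hat bC bE vC vE cCE = (vC - cCE) / ((bE - bC)\<^sup>2 + (vE + vC - 2 * cCE))"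
proof -
  define d where "d = (bE - bC)\<^sup>2 + (vE + vC - 2 * cCE)"
  define p0 where "p0 = (vC - cCE) / d"
  have d: "d > 0" using D by (simp add: d_def)
  have c: "vC - cCE = d * p0" using d by (simp add: p0_def)
  have Q: "emp_mse bC bE vC vE cCE p = vC - d * p0\<^sup>2 + d * (p - p0)\<^sup>2" for p
  proof -
    have "emp_mse bC bE vC vE cCE p = d * p\<^sup>2 - 2 * (vC - cCE) * p + vC"
      unfolding emp_mse_def d_def by (simp add: algebra_simps power2_eq_square)
    then show ?thesis unfolding c by (simp add: algebra_simps power2_eq_square)
  qed
  have "is_arg_min (emp_mse bC bE vC vE cCE) (\<lambda>_. True) (p_hat bC bE vC vE cCE)"
    unfolding p_hat_def arg_min_def
  proof (rule someI)
    show "is_arg_min (emp_mse bC bE vC vE cCE) (\<lambda>_. True) p0"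
      using d by (auto simp: is_arg_min_def Q not_less)
  qed
  then have "\<not> d * (p0 - p0)\<^sup>2 < d * (p_hat bC bE vC vE cCE - p0)\<^sup>2"
    unfolding is_arg_min_def Q by (auto dest: spec[of _ p0])
  then have "p_hat bC bE vC vE cCE = p0"
    using d by (simp add: zero_less_mult_iff)
  then show ?thesis by (simp add: p0_def d_def)
qed

definition beta_MSE :: "real \<Rightarrow> real \<Rightarrow> real \<Rightarrow> real \<Rightarrow> real \<Rightarrow> real" where
  "beta_MSE bC bE vC vE cCE =
     p_hat bC bE vC vE cCE * bE + (1 - p_hat bC bE vC vE cCE) * bC"

section \<open>Standing assumptions on a sequence of experiments\<close>

text \<open>
  The estimators for sample size \<open>n\<close> are random variables on the probability space \<open>M n\<close>.
  \<open>sC2\<close> and \<open>sE2\<close> stand for $\sigma_C^2$ and $\sigma_E^2$.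
\<close>

definition estimator_seq ::
  "real \<Rightarrow> real \<Rightarrow> (nat \<Rightarrow> 'a measure) \<Rightarrow>
   (nat \<Rightarrow> 'a \<Rightarrow> real) \<Rightarrow> (nat \<Rightarrow> 'a \<Rightarrow> real) \<Rightarrow>
   (nat \<Rightarrow> 'a \<Rightarrow> real) \<Rightarrow> (nat \<Rightarrow> 'a \<Rightarrow> real) \<Rightarrow> (nat \<Rightarrow> 'a \<Rightarrow> real) \<Rightarrow>
   (nat \<Rightarrow> real) \<Rightarrow> (nat \<Rightarrow> real) \<Rightarrow> bool" where
  "estimator_seq sC2 sE2 M bC bE vC vE cCE beta0 betaE \<longleftrightarrow>
     (\<forall>n. prob_space (M n) \<and>
          bC n \<in> borel_measurable (M n) \<and> bE n \<in> borel_measurable (M n) \<and>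
          vC n \<in> borel_measurable (M n) \<and> vE n \<in> borel_measurable (M n) \<and>
          cCE n \<in> borel_measurable (M n)) \<and>
     (\<exists>N :: (real^2) measure.
        normal_law 0 (vector [vector [sC2, sE2], vector [sE2, sE2]]) N \<and>
        conv_in_distr M
          (\<lambda>n \<omega>. sqrt (real n) *\<^sub>R vector [bC n \<omega> - beta0 n, bE n \<omega> - betaE n]) N) \<and>
     conv_in_prob M (\<lambda>n \<omega>. real n * vC n \<omega>) sC2 \<and>
     conv_in_prob M (\<lambda>n \<omega>. real n * vE n \<omega>) sE2 \<and>
     conv_in_prob M (\<lambda>n \<omega>. real n * cCE n \<omega>) sE2"

text \<open>The law of $\sqrt n(\widehat\beta_{MSE}-\beta_0)$ for sample size \<open>n\<close>.\<close>

definition mse_error_law ::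
  "(nat \<Rightarrow> 'a measure) \<Rightarrow>
   (nat \<Rightarrow> 'a \<Rightarrow> real) \<Rightarrow> (nat \<Rightarrow> 'a \<Rightarrow> real) \<Rightarrow>
   (nat \<Rightarrow> 'a \<Rightarrow> real) \<Rightarrow> (nat \<Rightarrow> 'a \<Rightarrow> real) \<Rightarrow> (nat \<Rightarrow> 'a \<Rightarrow> real) \<Rightarrow>
   (nat \<Rightarrow> real) \<Rightarrow> nat \<Rightarrow> real measure" where
  "mse_error_law M bC bE vC vE cCE beta0 n =
     distr (M n) borel
       (\<lambda>\<omega>. sqrt (real n) * (beta_MSE (bC n \<omega>) (bE n \<omega>) (vC n \<omega>) (vE n \<omega>) (cCE n \<omega>) - beta0 n))"

end

(*
  Let (X, Y) have the limiting normal law, t^2 = C - E with C, E the two asymptotic variances, and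
  D = X - Y. The covariance structure makes D ~ N(0, t^2) independent of Y ~ N(0, E).
  With betaE = beta0 + h / sqrt n the rescaled error of beta_MSE differs by o_p(1) from a continuous
  function of the rescaled estimators, and tends to U_h = X + t^2 (h - D) / ((h - D)^2 + t^2).
  For a fixed nonzero gap betaE - beta0 the correction term tends to 0 in probability.

  Stein's identity gives E U_h^2 = C + t^2 F(h/t) with F(k) = E psi(k - Z), Z standard normal,
  psi(w) = (3 w^2 - 2) / (1 + w^2)^2. Pointwise psi <= 9/20, hence F <= 9/20.
  F is continuous, vanishes at infinity, and takes values of both signs, so both extrema are attained.
  For u = 1 / (1 + Z^2), a = E u, Stein's identity yields E u^2 = 1/2 and E u^3 = (a + 1) / 4; then
  E (1 - u)(u - 1/2)^2 >= 0 and E u (1 - u)^2 >= 0 confine F(0) = 3 a - 5/2 to [-7/10, -1/2].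
  So max F < 1/2 <= - min F, and F(0) in (-1, 0) puts the variance of U_0 between E and C.
*)
theory Submission
  imports Defs "HOL-Real_Asymp.Real_Asymp"
begin

section \<open>Stein's identity\<close>

text \<open>\<open>sE2 = 0\<close> is allowed, so the limit in the plane may have no density; it is
  known only through its characteristic function. Every law is therefore handled on the real line:
  Levy uniqueness and continuity are applied to real images, and independence of D and Y enters only
  through the values it gives to the means of cos (r Y) f (D), sin (r Y) f (D) and Y f (D). The
  variance estimators converge separately, not jointly with the estimators. The passage to a
  continuous function of the rescaled estimators rests on a deterministic bound, uniform in their
  distance w, that holds wherever the variance estimators are near their limits. The number a = E u
  is the Mills ratio of the normal law at 1, about 0.656, so F(0) is about -0.533. It is enclosed by
  means of nonnegative cubics in u, whose means involve only a. The bound on max F can afford to be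
  pointwise because 9/20 is already below 1/2; the maximiser is never located.\<close>

lemma integrable_std_normal_bounded:
  fixes f :: "real \<Rightarrow> 'b :: {banach, second_countable_topology}"
  assumes "f \<in> borel_measurable borel" "\<And>x. norm (f x) \<le> B"
  shows "integrable std_normal_distribution f"
proof -
  interpret real_distribution std_normal_distribution by (rule real_dist_normal_dist)
  show ?thesis
    by (rule integrable_const_bound[of _ B]) (use assms in auto)
qed

lemma std_normal_second_moment:
  "integrable std_normal_distribution (\<lambda>x. x\<^sup>2)" "(LINT x|std_normal_distribution. x\<^sup>2) = 1"
  using std_normal_distribution_even_moments[of 1] by (simp_all add: fact_numeral)

lemma std_normal_fourth_moment:
  "integrable std_normal_distribution (\<lambda>x. x^4)" "(LINT x|std_normal_distribution. x^4) = 3"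
  using std_normal_distribution_even_moments[of 2] by (simp_all add: fact_numeral)

lemma std_normal_first_moment:
  "integrable std_normal_distribution (\<lambda>x. x)" "(LINT x|std_normal_distribution. x) = 0"
  using integrable_std_normal_distribution_moment[of 1] integral_std_normal_distribution_moment_odd[of 1] by simp_all

lemma std_normal_integral_symmetric:
  fixes f :: "real \<Rightarrow> real"
  assumes "\<And>x. f (- x) = - f x"
  shows "(LINT x|std_normal_distribution. f x) = 0"
proof (cases "f \<in> borel_measurable borel")
  case True
  note [measurable] = this
  have *: "(LINT x|std_normal_distribution. f x) = (\<integral>x. std_normal_density x * f x \<partial>lborel)"
    by (simp add: integral_density)
  also have "\<dots> = (\<integral>x. std_normal_density (-x) * f (-x) \<partial>lborel)"
    using lborel_integral_real_affine[of "-1" "\<lambda>x. std_normal_density x * f x" 0] by simp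
  also have "\<dots> = (\<integral>x. - (std_normal_density x * f x) \<partial>lborel)"
    using assms by (simp add: normal_density_def)
  also have "\<dots> = - (LINT x|std_normal_distribution. f x)"
    by (simp add: *)
  finally show ?thesis by simp
next
  \<comment> \<open>A non-measurable function is not integrable, and its integral is 0 by
    convention.\<close>
  case False
  then have "\<not> integrable std_normal_distribution f"
    by (auto dest: borel_measurable_integrable)
  then show ?thesis by (rule not_integrable_integral_eq)
qed

text \<open>Integration by parts on the whole line: \<open>F\<close>, the product of
  \<open>g\<close> and the density, has derivative \<open>f\<close> and vanishes at both ends
  because \<open>g\<close> is bounded, so the integral of \<open>f\<close> is 0.\<close>

lemma stein_identity:
  fixes g g' :: "real \<Rightarrow> real"
  assumes g: "\<And>x. (g has_real_derivative g' x) (at x)"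
    and g': "continuous_on UNIV g'"
    and B: "\<And>x. \<bar>g x\<bar> \<le> B" "\<And>x. \<bar>g' x\<bar> \<le> B"
  shows "(LINT x|std_normal_distribution. x * g x) = (LINT x|std_normal_distribution. g' x)"
    and "integrable std_normal_distribution (\<lambda>x. x * g x)"
proof -
  define F where "F x = g x * std_normal_density x" for x
  define f where "f x = std_normal_density x * g' x - std_normal_density x * (x * g x)" for x
  have cg: "continuous_on UNIV g"
    using g by (meson DERIV_isCont continuous_at_imp_continuous_on)
  have [measurable]: "g \<in> borel_measurable borel" "g' \<in> borel_measurable borel"
    using cg g' by (auto intro: borel_measurable_continuous_onI)
  have B0: "B \<ge> 0" using B(1)[of 0] by linarith
  show i1: "integrable std_normal_distribution (\<lambda>x. x * g x)"
  proof (rule Bochner_Integration.integrable_bound)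
    show "integrable std_normal_distribution (\<lambda>x. B * x)"
      using std_normal_first_moment(1) by (rule integrable_mult_right)
    show "AE x in std_normal_distribution. norm (x * g x) \<le> norm (B * x)"
      using B(1) B0 by (auto simp: abs_mult intro!: AE_I2 mult_right_mono intro: order_trans[OF mult.commute[THEN eq_refl]])
  qed simp
  have i2: "integrable std_normal_distribution g'"
    by (rule integrable_std_normal_bounded[of _ B]) (use B(2) in auto)
  have i1': "integrable lborel (\<lambda>x. std_normal_density x * (x * g x))"
    using i1 by (subst (asm) integrable_density) auto
  have i2': "integrable lborel (\<lambda>x. std_normal_density x * g' x)"
    using i2 by (subst (asm) integrable_density) auto
  have if_: "integrable lborel f"
    unfolding f_def using i1' i2' by simp
  have d: "(F has_vector_derivative f x) (at x)" for x
  proof -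
    define c where "c = 1 / sqrt (2 * pi)"
    have "std_normal_density = (\<lambda>x. c * exp (- x\<^sup>2 / 2))"
      by (auto simp: normal_density_def c_def)
    then show ?thesis
      unfolding F_def f_def has_real_derivative_iff_has_vector_derivative[symmetric]
      by (auto intro!: derivative_eq_intros g simp: algebra_simps)
  qed
  have "continuous_on UNIV f"
    unfolding f_def normal_density_def by (intro continuous_intros cg g') auto
  then have c: "isCont f x" for x
    by (simp add: continuous_on_eq_continuous_at)
  have lim: "(F \<longlongrightarrow> 0) G" if "(std_normal_density \<longlongrightarrow> 0) G" for G
  proof (rule Lim_null_comparison)
    show "\<forall>\<^sub>F x in G. norm (F x) \<le> B * std_normal_density x"
      using B(1) by (auto simp: F_def abs_mult intro!: always_eventually mult_right_mono)
    show "((\<lambda>x. B * std_normal_density x) \<longlongrightarrow> 0) G"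
      using tendsto_mult_right_zero[OF that] by simp
  qed
  have "(std_normal_density \<longlongrightarrow> 0) at_top" "(std_normal_density \<longlongrightarrow> 0) at_bot"
    unfolding normal_density_def by real_asymp+
  then have "(F \<longlongrightarrow> 0) at_top" "(F \<longlongrightarrow> 0) at_bot"
    by (auto intro: lim)
  then have "(LBINT x=-\<infinity>..\<infinity>. f x) = 0 - 0"
    using d c if_ by (intro interval_integral_FTC_integrable[where F=F])
      (auto simp: ereal_tendsto_simps set_integrable_def)
  then have "(\<integral>x. f x \<partial>lborel) = 0"
    by (simp add: interval_lebesgue_integral_def set_lebesgue_integral_def)
  then have "(\<integral>x. std_normal_density x * g' x \<partial>lborel) = (\<integral>x. std_normal_density x * (x * g x) \<partial>lborel)"
    unfolding f_def using i1' i2' by simp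
  then show "(LINT x|std_normal_distribution. x * g x) = (LINT x|std_normal_distribution. g' x)"
    by (simp add: integral_density)
qed

section \<open>The asymptotic risk\<close>

text \<open>
  In units of \<open>t\<close>, the correction to \<open>bC\<close> at distance \<open>w\<close> between the two estimators is \<open>shrink w\<close>.
  Its effect on the risk is \<open>2 Z (shrink (k - Z)) + (shrink (k - Z))\<^sup>2\<close>, with the same mean as
  \<open>excess_risk (k - Z)\<close>, since \<open>excess_risk = - 2 shrink' + shrink\<^sup>2\<close>.
\<close>

definition shrink :: "real \<Rightarrow> real" where "shrink w = w / (1 + w\<^sup>2)"

definition excess_risk :: "real \<Rightarrow> real" where "excess_risk w = (3 * w\<^sup>2 - 2) / (1 + w\<^sup>2)\<^sup>2"

lemma one_plus_square_pos: "0 < 1 + (x::real)\<^sup>2"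
  by (simp add: add_pos_nonneg)

text \<open>In u = 1 / (1 + w^2), which lies in (0, 1], the risk is the parabola 3 u - 5 u^2, with
  vertex 9/20 at u = 3/10 and lowest value -2 at u = 1. Its mean at shift 0 needs only two moments
  of u.\<close>

lemma excess_risk_eq: "excess_risk w = 3 * (1 / (1 + w\<^sup>2)) - 5 * (1 / (1 + w\<^sup>2))\<^sup>2"
proof -
  have "1 + w\<^sup>2 \<noteq> 0" using one_plus_square_pos[of w] by simp
  then show ?thesis
    unfolding excess_risk_def by (simp add: divide_simps) (simp add: power2_eq_square algebra_simps)
qed

lemma excess_risk_le: "excess_risk w \<le> 9 / 20"
proof -
  have "9/20 - (3 * u - 5 * u\<^sup>2) = 5 * (u - 3/10)\<^sup>2" for u :: real
    by (simp add: power2_eq_square algebra_simps)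
  from this[of "1 / (1 + w\<^sup>2)"] show ?thesis
    unfolding excess_risk_eq using zero_le_power2[of "1 / (1 + w\<^sup>2) - 3/10"] by linarith
qed

lemma inverse_one_plus_square: "0 \<le> 1 / (1 + (w::real)\<^sup>2)" "1 / (1 + (w::real)\<^sup>2) \<le> 1"
  using one_plus_square_pos[of w] by auto

lemma abs_excess_risk_le: "\<bar>excess_risk w\<bar> \<le> 3 / (1 + w\<^sup>2)"
proof -
  define u where "u = 1 / (1 + w\<^sup>2)"
  have u: "0 \<le> u" "u \<le> 1" using inverse_one_plus_square unfolding u_def by auto
  have "u\<^sup>2 \<le> u" "0 \<le> u\<^sup>2" using u by (auto simp: power2_eq_square mult_left_le)
  then have "\<bar>3 * u - 5 * u\<^sup>2\<bar> \<le> 3 * u" using u by linarith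
  then show ?thesis unfolding excess_risk_eq u_def by simp
qed

lemma excess_risk_bounded: "\<bar>excess_risk w\<bar> \<le> 3"
  using abs_excess_risk_le[of w] inverse_one_plus_square[of w] by simp

lemma continuous_excess_risk: "continuous_on UNIV excess_risk"
proof -
  have "1 + x\<^sup>2 \<noteq> 0" for x :: real using one_plus_square_pos[of x] by simp
  then show ?thesis unfolding excess_risk_def by (intro continuous_intros) auto
qed

lemma borel_measurable_excess_risk [measurable]: "excess_risk \<in> borel_measurable borel"
  using continuous_excess_risk by (rule borel_measurable_continuous_onI)

section \<open>Continuity, decay and sign of the mean excess risk\<close>

definition mean_excess_risk :: "real \<Rightarrow> real" where
  "mean_excess_risk k = (LINT z|std_normal_distribution. excess_risk (k - z))"

lemma integrable_excess_risk: "integrable std_normal_distribution (\<lambda>z. excess_risk (k - z))"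
  by (rule integrable_std_normal_bounded[of _ 3]) (auto simp: excess_risk_bounded)

lemma integral_std_normal_const [simp]: "(LINT z|std_normal_distribution. (c::real)) = c"
proof -
  interpret real_distribution std_normal_distribution by (rule real_dist_normal_dist)
  show ?thesis using prob_space by simp
qed

lemma integrable_std_normal_const: "integrable std_normal_distribution (\<lambda>z. (c::real))"
  by (rule integrable_std_normal_bounded[of _ "\<bar>c\<bar>"]) auto

lemma continuous_mean_excess_risk: "continuous_on UNIV mean_excess_risk"
proof -
  have "isCont mean_excess_risk k" for k
    unfolding continuous_at_sequentially
  proof safe
    fix x assume x: "x \<longlonglongrightarrow> k"
    have c: "isCont excess_risk y" for y
      using continuous_excess_risk by (simp add: continuous_on_eq_continuous_at)
    show "(mean_excess_risk \<circ> x) \<longlonglongrightarrow> mean_excess_risk k"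
      unfolding o_def mean_excess_risk_def
    proof (rule integral_dominated_convergence[where w="\<lambda>_. 3"])
      show "AE z in std_normal_distribution. (\<lambda>i. excess_risk (x i - z)) \<longlonglongrightarrow> excess_risk (k - z)"
        using x by (intro AE_I2 isCont_tendsto_compose[OF c] tendsto_intros)
    qed (auto simp: excess_risk_bounded integrable_std_normal_const)
  qed
  then show ?thesis by (simp add: continuous_on_eq_continuous_at)
qed

lemma mean_excess_risk_le: "mean_excess_risk k \<le> 9 / 20"
proof -
  have "mean_excess_risk k \<le> (LINT z|std_normal_distribution. (9/20::real))"
    unfolding mean_excess_risk_def
    by (intro integral_mono integrable_excess_risk integrable_std_normal_const excess_risk_le)
  then show ?thesis by (simp only: integral_std_normal_const)
qed

text \<open>The constant is 3 * 2 * 2: the 3 of \<open>abs_excess_risk_le\<close>, the factor 2 for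
  trading decay in k - z for decay in k, and the mean 2 of 1 + Z^2. The decay confines the search
  for extrema to a compact interval.\<close>

lemma abs_mean_excess_risk_le: "\<bar>mean_excess_risk k\<bar> \<le> 12 / (1 + k\<^sup>2)"
proof -
  have *: "norm (excess_risk (k - z)) \<le> 6 / (1 + k\<^sup>2) + 6 / (1 + k\<^sup>2) * z\<^sup>2" for z
  proof -
    \<comment> \<open>Peetre's inequality, with the difference of the two sides written as a sum of squares\<close>
    have "2 * (1 + z\<^sup>2) * (1 + (k - z)\<^sup>2) - (1 + k\<^sup>2) = 1 + (k - 2 * z)\<^sup>2 + 2 * (z * (k - z))\<^sup>2"
      by (simp add: power2_eq_square algebra_simps)
    also have "\<dots> \<ge> 0" by simp
    finally have "3 * (1 + k\<^sup>2) \<le> (6 * (1 + z\<^sup>2)) * (1 + (k - z)\<^sup>2)"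
      by (simp add: algebra_simps)
    then have "3 / (1 + (k - z)\<^sup>2) \<le> 6 * (1 + z\<^sup>2) / (1 + k\<^sup>2)"
      by (simp only: pos_divide_le_eq pos_le_divide_eq one_plus_square_pos times_divide_eq_left)
    then show ?thesis
      using abs_excess_risk_le[of "k - z"] by (simp add: add_divide_distrib distrib_left)
  qed
  have i: "integrable std_normal_distribution (\<lambda>z. 6 / (1 + k\<^sup>2) + 6 / (1 + k\<^sup>2) * z\<^sup>2)"
    by (intro Bochner_Integration.integrable_add integrable_std_normal_const integrable_mult_right std_normal_second_moment)
  have "\<bar>mean_excess_risk k\<bar> \<le> (LINT z|std_normal_distribution. norm (excess_risk (k - z)))"
    unfolding mean_excess_risk_def using integral_norm_bound[of _ "\<lambda>z. excess_risk (k - z)"] by simp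
  also have "\<dots> \<le> (LINT z|std_normal_distribution. 6 / (1 + k\<^sup>2) + 6 / (1 + k\<^sup>2) * z\<^sup>2)"
    by (intro integral_mono * i integrable_norm integrable_excess_risk)
  also have "\<dots> = 6 / (1 + k\<^sup>2) + 6 / (1 + k\<^sup>2) * 1"
    by (simp only: Bochner_Integration.integral_add integrable_std_normal_const integral_std_normal_const
        integrable_mult_right std_normal_second_moment integral_mult_right_zero)
  also have "\<dots> = 12 / (1 + k\<^sup>2)" by simp
  finally show ?thesis .
qed

text \<open>
  Far from the origin \<open>excess_risk\<close> is positive near \<open>k\<close>. The quartic minorant \<open>c - K (w - k)\<^sup>4\<close> also
  covers the region near 0 where it is as low as \<open>- 2\<close>, and its mean is \<open>c - 3 K\<close>.
\<close>

lemma mean_excess_risk_pos: "0 < mean_excess_risk 100"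
proof -
  \<comment> \<open>The estimate for 50 <= w <= 150 needs c * 22501^2 <= 3 * 2500 - 2, and c is a
    rounded-down solution. \<open>K\<close> is set so that c - K * 50^4 = -2, the lowest value of
    \<open>excess_risk\<close>. With z^2 in place of z^4 the analogous K would be about 8e-4, far
    above c, and the mean of the minorant would be negative.\<close>
  define c :: real where "c = 14 / 10^6"
  define K :: real where "K = 16 * (2 + c) / 100^4"
  have *: "c - K * z^4 \<le> excess_risk (100 - z)" for z :: real
  proof (cases "\<bar>z\<bar> \<le> 50")
    case True
    define w where "w = 100 - z"
    have w: "50 \<le> w" "w \<le> 150" using True by (auto simp: w_def)
    then have w2: "2500 \<le> w\<^sup>2" "w\<^sup>2 \<le> 22500"
      using power_mono[of 50 w 2] power_mono[of w 150 2] by auto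
    have "(1 + w\<^sup>2)\<^sup>2 \<le> 22501\<^sup>2" by (rule power_mono) (use w2 in auto)
    then have "c * (1 + w\<^sup>2)\<^sup>2 \<le> 3 * w\<^sup>2 - 2"
      using w2 unfolding c_def by simp
    then have "c \<le> excess_risk w"
      unfolding excess_risk_def using one_plus_square_pos[of w] by (simp add: pos_le_divide_eq)
    moreover have "0 \<le> K * z^4" unfolding K_def c_def by simp
    ultimately show ?thesis unfolding w_def by linarith
  next
    case False
    have "(50::real)^4 \<le> \<bar>z\<bar>^4" by (rule power_mono) (use False in auto)
    then have "K * 50^4 \<le> K * z^4"
      by (intro mult_left_mono) (auto simp: K_def c_def)
    then have "c - K * z^4 \<le> - 2" by (simp add: K_def c_def)
    also have "-2 \<le> excess_risk (100 - z)"
    proof -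
      define u where "u = 1 / (1 + (100 - z)\<^sup>2)"
      have u: "0 \<le> u" "u \<le> 1" using inverse_one_plus_square unfolding u_def by auto
      then have "u\<^sup>2 \<le> u" "u\<^sup>2 \<le> 1" by (auto simp: power2_eq_square mult_left_le mult_le_one)
      then have "-2 \<le> 3 * u - 5 * u\<^sup>2" by linarith
      then show ?thesis unfolding excess_risk_eq u_def .
    qed
    finally show ?thesis .
  qed
  have i: "integrable std_normal_distribution (\<lambda>z. K * z^4)"
    by (intro integrable_mult_right std_normal_fourth_moment)
  have "0 < c - K * 3" by (simp add: c_def K_def)
  also have "c - K * 3 = (LINT z|std_normal_distribution. c - K * z^4)"
    by (subst Bochner_Integration.integral_diff)
      (simp_all only: integrable_std_normal_const i integral_std_normal_const, simp add: std_normal_fourth_moment)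
  also have "\<dots> \<le> mean_excess_risk 100"
    unfolding mean_excess_risk_def
    by (intro integral_mono * integrable_excess_risk Bochner_Integration.integrable_diff integrable_std_normal_const i)
  finally show ?thesis .
qed

lemma attains_max:
  fixes f :: "real \<Rightarrow> real"
  assumes c: "continuous_on UNIV f" and K: "\<And>k. f k \<le> K / (1 + k\<^sup>2)" and p: "0 < f k0"
  shows "\<exists>k1. \<forall>k. f k \<le> f k1"
proof -
  \<comment> \<open>The first term puts \<open>k0\<close> inside the interval, the 1 gives R <= R^2
    <= 1 + y^2 outside it, and the quotient makes K / (1 + y^2) <= f k0 there.\<close>
  define R where "R = max \<bar>k0\<bar> (max 1 (K / f k0))"
  have R: "\<bar>k0\<bar> \<le> R" "1 \<le> R" "K \<le> R * f k0"
    using p by (auto simp: R_def pos_divide_le_eq[symmetric])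
  have "\<exists>x\<in>{-R..R}. \<forall>y\<in>{-R..R}. f y \<le> f x"
    by (rule continuous_attains_sup) (use R c in \<open>auto intro: continuous_on_subset\<close>)
  then obtain x where x: "\<And>y. y \<in> {-R..R} \<Longrightarrow> f y \<le> f x" by blast
  have "f y \<le> f x" for y
  proof (cases "y \<in> {-R..R}")
    case True then show ?thesis by (rule x)
  next
    case False
    then have "R\<^sup>2 \<le> y\<^sup>2" using R by (subst abs_le_square_iff[symmetric]) auto
    moreover have "R * 1 \<le> R\<^sup>2" unfolding power2_eq_square using R by (intro mult_left_mono) auto
    ultimately have "R \<le> 1 + y\<^sup>2" by simp
    then have "R * f k0 \<le> (1 + y\<^sup>2) * f k0" using p by (intro mult_right_mono) auto
    then have "K / (1 + y\<^sup>2) \<le> f k0"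
      using R one_plus_square_pos[of y] by (simp add: pos_divide_le_eq mult.commute)
    also have "f k0 \<le> f x" using R by (intro x) auto
    finally show ?thesis using K[of y] by simp
  qed
  then show ?thesis by (intro exI[of _ x] allI)
qed


lemma DERIV_shrink:
  "(shrink has_real_derivative ((1 - w\<^sup>2) / (1 + w\<^sup>2)\<^sup>2)) (at w)"
proof -
  have "1 + w\<^sup>2 \<noteq> 0" using one_plus_square_pos[of w] by simp
  then show ?thesis
    unfolding shrink_def[abs_def]
    by (auto intro!: derivative_eq_intros simp: power2_eq_square algebra_simps)
qed

lemma abs_shrink_le: "\<bar>shrink w\<bar> \<le> 1"
proof -
  have "0 \<le> (\<bar>w\<bar> - 1)\<^sup>2" "0 \<le> w\<^sup>2" by simp_all
  then have "\<bar>w\<bar> \<le> 1 + w\<^sup>2"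
    unfolding power2_diff by simp
  then show ?thesis
    using one_plus_square_pos[of w] unfolding shrink_def by (simp add: abs_divide)
qed

lemma abs_shrink_deriv_le: "\<bar>(1 - w\<^sup>2) / (1 + w\<^sup>2)\<^sup>2\<bar> \<le> (1::real)"
proof -
  have "\<bar>1 - w\<^sup>2\<bar> \<le> (1 + w\<^sup>2) * 1" by (auto simp: abs_le_iff)
  also have "\<dots> \<le> (1 + w\<^sup>2) * (1 + w\<^sup>2)" by (intro mult_left_mono) auto
  finally show ?thesis
    using one_plus_square_pos[of w] by (simp add: abs_divide power2_eq_square)
qed

lemma continuous_shrink: "continuous_on UNIV shrink"
  using DERIV_shrink by (meson DERIV_isCont continuous_at_imp_continuous_on)

lemma borel_measurable_shrink [measurable]: "shrink \<in> borel_measurable borel"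
  using continuous_shrink by (rule borel_measurable_continuous_onI)

lemma std_normal_shrinkage_risk:
  shows "(LINT z|std_normal_distribution. 2 * (z * shrink (k - z)) + (shrink (k - z))\<^sup>2) = mean_excess_risk k"
    and "integrable std_normal_distribution (\<lambda>z. z * shrink (k - z))"
    and "integrable std_normal_distribution (\<lambda>z. (shrink (k - z))\<^sup>2)"
proof -
  define p' where "p' z = - ((1 - (k - z)\<^sup>2) / (1 + (k - z)\<^sup>2)\<^sup>2)" for z
  have nz: "1 + (k - z)\<^sup>2 \<noteq> 0" for z using one_plus_square_pos[of "k - z"] by simp
  have 1: "((\<lambda>z. shrink (k - z)) has_real_derivative p' z) (at z)" for z
  proof -
    have "((\<lambda>z. k - z) has_real_derivative - 1) (at z)"
      by (auto intro!: derivative_eq_intros)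
    from DERIV_chain2[OF DERIV_shrink this] show ?thesis by (simp add: p'_def)
  qed
  have 2: "continuous_on UNIV p'"
    unfolding p'_def using nz by (intro continuous_intros) auto
  then have [measurable]: "p' \<in> borel_measurable borel"
    by (rule borel_measurable_continuous_onI)
  have 3: "\<bar>p' z\<bar> \<le> 1" for z unfolding p'_def using abs_shrink_deriv_le[of "k - z"] by simp
  note stein = stein_identity[OF 1 2 abs_shrink_le 3]
  show i1: "integrable std_normal_distribution (\<lambda>z. z * shrink (k - z))" by (rule stein(2))
  show i2: "integrable std_normal_distribution (\<lambda>z. (shrink (k - z))\<^sup>2)"
    by (rule integrable_std_normal_bounded[of _ 1]) (auto simp: abs_shrink_le abs_square_le_1)
  have i3: "integrable std_normal_distribution p'"
    by (rule integrable_std_normal_bounded[of _ 1]) (auto simp: 3)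
  \<comment> \<open>With w = k - z the numerators combine as -2 (1 - w^2) + w^2 = 3 w^2 - 2; the
    minus sign in \<open>p'\<close> is the inner derivative of k - z.\<close>
  have e: "2 * p' z + (shrink (k - z))\<^sup>2 = excess_risk (k - z)" for z
    unfolding p'_def shrink_def excess_risk_def power_divide
    by (simp add: diff_divide_distrib[symmetric] add_divide_distrib[symmetric])
  have "(LINT z|std_normal_distribution. 2 * (z * shrink (k - z)) + (shrink (k - z))\<^sup>2)
    = 2 * (LINT z|std_normal_distribution. z * shrink (k - z)) + (LINT z|std_normal_distribution. (shrink (k - z))\<^sup>2)"
    using i1 i2 by simp
  also have "\<dots> = 2 * (LINT z|std_normal_distribution. p' z) + (LINT z|std_normal_distribution. (shrink (k - z))\<^sup>2)"
    using stein(1) by simp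
  also have "\<dots> = (LINT z|std_normal_distribution. 2 * p' z + (shrink (k - z))\<^sup>2)"
    using i3 i2 by simp
  finally show "(LINT z|std_normal_distribution. 2 * (z * shrink (k - z)) + (shrink (k - z))\<^sup>2) = mean_excess_risk k"
    unfolding mean_excess_risk_def e .
qed

lemma mean_excess_risk_0: "- 1 < mean_excess_risk 0" "mean_excess_risk 0 \<le> - 1 / 2"
proof -
  define u :: "real \<Rightarrow> real" where "u z = 1 / (1 + z\<^sup>2)" for z
  define a where "a n = (LINT z|std_normal_distribution. u z ^ n)" for n
  have nz: "1 + z\<^sup>2 \<noteq> 0" for z :: real using one_plus_square_pos[of z] by simp
  have u01: "0 \<le> u z" "u z \<le> 1" for z unfolding u_def using inverse_one_plus_square[of z] by auto
  have cu: "continuous_on UNIV u" unfolding u_def using nz by (intro continuous_intros) auto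
  then have [measurable]: "u \<in> borel_measurable borel" by (rule borel_measurable_continuous_onI)
  have un1: "\<bar>u z ^ n\<bar> \<le> 1" for z n using u01[of z] by (simp add: power_le_one)
  have iu: "integrable std_normal_distribution (\<lambda>z. u z ^ n)" for n
    by (rule integrable_std_normal_bounded[of _ 1]) (auto simp: un1)
  have zu: "z\<^sup>2 * u z = 1 - u z" for z unfolding u_def using nz[of z] by (simp add: field_simps)
  \<comment> \<open>Stein's identity for \<open>z * u z ^ Suc n\<close>, rewritten with \<open>z\<^sup>2 * u z = 1 - u z\<close>\<close>
  have stein: "a n - a (Suc n) = (1 - 2 * real (Suc n)) * a (Suc n) + 2 * real (Suc n) * a (Suc (Suc n))" for n
  proof -
    define g where "g z = z * u z ^ Suc n" for z
    define g' where "g' z = (1 - 2 * real (Suc n)) * u z ^ Suc n + 2 * real (Suc n) * u z ^ Suc (Suc n)" for z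
    have du: "(u has_real_derivative (- 2 * z * (u z)\<^sup>2)) (at z)" for z
      unfolding u_def using nz[of z]
      by (auto intro!: derivative_eq_intros simp: power2_eq_square)
    have 1: "(g has_real_derivative g' z) (at z)" for z
    proof -
      have "(g has_real_derivative (u z ^ Suc n + z * (real (Suc n) * u z ^ n * (- 2 * z * (u z)\<^sup>2)))) (at z)"
        unfolding g_def using DERIV_mult[OF DERIV_ident DERIV_power[OF du, of "Suc n"]]
        by (simp add: algebra_simps)
      also have "z * (real (Suc n) * u z ^ n * (- 2 * z * (u z)\<^sup>2)) = - 2 * real (Suc n) * u z ^ Suc n * (z\<^sup>2 * u z)"
        by (simp add: power2_eq_square algebra_simps)
      also have "u z ^ Suc n + \<dots> = g' z"
        unfolding zu g'_def by (simp add: algebra_simps)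
      finally show ?thesis .
    qed
    have 2: "continuous_on UNIV g'" unfolding g'_def by (intro continuous_intros cu)
    define B where "B = \<bar>1 - 2 * real (Suc n)\<bar> + 2 * real (Suc n)"
    have 3: "\<bar>g' z\<bar> \<le> B" for z
    proof -
      have "\<bar>g' z\<bar> \<le> \<bar>(1 - 2 * real (Suc n)) * u z ^ Suc n\<bar> + \<bar>2 * real (Suc n) * u z ^ Suc (Suc n)\<bar>"
        unfolding g'_def by (rule abs_triangle_ineq)
      also have "\<dots> \<le> B"
        unfolding abs_mult B_def
        by (intro add_mono mult_left_le order_trans[OF mult_left_le[OF un1]]) auto
      finally show ?thesis .
    qed
    have 4: "\<bar>g z\<bar> \<le> B" for z
    proof -
      have "\<bar>z * u z\<bar> \<le> 1" using abs_shrink_le[of z] by (simp add: u_def shrink_def)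
      then have "\<bar>z * u z\<bar> * \<bar>u z ^ n\<bar> \<le> 1 * 1" by (intro mult_mono un1) auto
      also have "1 * 1 \<le> B" unfolding B_def by simp
      finally show ?thesis unfolding g_def by (simp add: abs_mult mult.assoc)
    qed
    have zg: "z * g z = u z ^ n - u z ^ Suc n" for z
    proof -
      have "z * g z = u z ^ n * (z\<^sup>2 * u z)" by (simp add: g_def power2_eq_square)
      then show ?thesis unfolding zu by (simp add: algebra_simps)
    qed
    have "a n - a (Suc n) = (LINT z|std_normal_distribution. z * g z)"
      unfolding a_def zg by (subst Bochner_Integration.integral_diff) (auto intro: iu simp del: power_Suc)
    also have "(LINT z|std_normal_distribution. z * g z) = (LINT z|std_normal_distribution. g' z)"
      by (rule stein_identity(1)[OF 1 2 4 3])
    also have "\<dots> = (1 - 2 * real (Suc n)) * a (Suc n) + 2 * real (Suc n) * a (Suc (Suc n))"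
      unfolding a_def g'_def
      by (subst Bochner_Integration.integral_add) (auto intro!: iu integrable_mult_right simp del: power_Suc)
    finally show ?thesis .
  qed
  have a0: "a 0 = 1" unfolding a_def by (simp only: power_0 integral_std_normal_const)
  \<comment> \<open>At index 0 the terms in \<open>a 1\<close> cancel, which determines
    \<open>a 2\<close>. Index 1 then gives \<open>a 3\<close> through \<open>a 1\<close>, which the
    recursion leaves free.\<close>
  have a2: "a 2 = 1 / 2" using stein[of 0] a0 by (simp add: numeral_eq_Suc)
  have a3: "a 3 = (a 1 + 1) / 4" using stein[of 1] a2 by (simp add: numeral_eq_Suc)
  \<comment> \<open>The integrands below are padded to this cubic shape, with \<open>0 +\<close>,
    \<open>u z ^ 1\<close> and zero coefficients, so that they can be rewritten by
    \<open>lin\<close>.\<close>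
  have lin: "(LINT z|std_normal_distribution. c0 + c1 * u z ^ 1 + c2 * u z ^ 2 + c3 * u z ^ 3)
      = c0 + c1 * a 1 + c2 * a 2 + c3 * a 3" for c0 c1 c2 c3
  proof -
    have i: "integrable std_normal_distribution (\<lambda>z. c * u z ^ n)" for c n
      by (intro integrable_mult_right iu)
    show ?thesis
      by (simp only: Bochner_Integration.integral_add Bochner_Integration.integrable_add i
          integrable_std_normal_const integral_std_normal_const integral_mult_right_zero a_def)
  qed
  \<comment> \<open>The mean is 1 - 3/2 * a 1. Among the cubics (1 - u) (u - r)^2 with r > 0, the
    choice r = 1/2 gives the smallest upper bound for \<open>a 1\<close>.\<close>
  have "0 \<le> (LINT z|std_normal_distribution. 1/4 + (-5/4) * u z ^ 1 + 2 * u z ^ 2 + (-1) * u z ^ 3)"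
  proof (rule Bochner_Integration.integral_nonneg)
    fix z :: real
    have "1/4 + (-5/4) * u z ^ 1 + 2 * u z ^ 2 + (-1) * u z ^ 3 = (1 - u z) * (u z - 1/2)\<^sup>2"
      by (simp add: power2_eq_square power3_eq_cube field_simps)
    also have "\<dots> \<ge> 0" using u01[of z] by simp
    finally show "0 \<le> 1/4 + (-5/4) * u z ^ 1 + 2 * u z ^ 2 + (-1) * u z ^ 3" .
  qed
  then have hi: "a 1 \<le> 2 / 3" unfolding lin a2 a3 by argo
  \<comment> \<open>The mean is 5/4 * a 1 - 3/4. A crude bound suffices:
    \<open>- 1 < mean_excess_risk 0\<close> amounts to 1/2 < a 1.\<close>
  have "0 \<le> (LINT z|std_normal_distribution. 0 + 1 * u z ^ 1 + (-2) * u z ^ 2 + 1 * u z ^ 3)"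
  proof (rule Bochner_Integration.integral_nonneg)
    fix z :: real
    have "0 + 1 * u z ^ 1 + (-2) * u z ^ 2 + 1 * u z ^ 3 = u z * (1 - u z)\<^sup>2"
      by (simp add: power2_eq_square power3_eq_cube algebra_simps)
    also have "\<dots> \<ge> 0" using u01[of z] by simp
    finally show "0 \<le> 0 + 1 * u z ^ 1 + (-2) * u z ^ 2 + 1 * u z ^ 3" .
  qed
  then have lo: "3 / 5 \<le> a 1" unfolding lin a2 a3 by argo
  have "mean_excess_risk 0 = (LINT z|std_normal_distribution. 0 + 3 * u z ^ 1 + (-5) * u z ^ 2 + 0 * u z ^ 3)"
    unfolding mean_excess_risk_def excess_risk_eq u_def by simp
  also have "\<dots> = 3 * a 1 - 5 / 2" unfolding lin a2 by simp
  finally show "- 1 < mean_excess_risk 0" "mean_excess_risk 0 \<le> - 1 / 2" using hi lo by simp_all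
qed

lemma mean_excess_risk_has_max: "\<exists>k1. \<forall>k. mean_excess_risk k \<le> mean_excess_risk k1"
proof -
  have b: "mean_excess_risk k \<le> 12 / (1 + k\<^sup>2)" for k
    using abs_mean_excess_risk_le[of k] by linarith
  show ?thesis
    by (rule attains_max[OF continuous_mean_excess_risk b mean_excess_risk_pos])
qed

lemma mean_excess_risk_has_min: "\<exists>k2. \<forall>k. mean_excess_risk k2 \<le> mean_excess_risk k"
proof -
  have b: "- mean_excess_risk k \<le> 12 / (1 + k\<^sup>2)" for k
    using abs_mean_excess_risk_le[of k] by linarith
  have p: "0 < - mean_excess_risk 0" using mean_excess_risk_0 by linarith
  have c: "continuous_on UNIV (\<lambda>k. - mean_excess_risk k)"
    by (rule continuous_on_minus[OF continuous_mean_excess_risk])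
  show ?thesis
    using attains_max[OF c b p] unfolding neg_le_iff_le .
qed

lemma mean_excess_risk_max_less:
  assumes "\<forall>k. mean_excess_risk k2 \<le> mean_excess_risk k"
  shows "mean_excess_risk k1 < - mean_excess_risk k2"
proof -
  have "mean_excess_risk k2 \<le> - 1 / 2"
    by (rule order_trans[OF spec[OF assms] mean_excess_risk_0(2)])
  with mean_excess_risk_le[of k1] show ?thesis by simp
qed

section \<open>Uncorrelated jointly normal pairs\<close>

lemma borel_measurable_cis [measurable]: "cis \<in> borel_measurable borel"
  by (intro borel_measurable_continuous_onI continuous_intros)

lemma char_eq_cis: "char M s = (CLINT x|M. cis (s * x))"
  unfolding char_def cis_conv_exp ..

lemma char_distr_eq_cis:
  "f \<in> borel_measurable M \<Longrightarrow> char (distr M borel f) s = (CLINT x|M. cis (s * f x))"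
  unfolding char_eq_cis by (subst integral_distr) simp_all

lemma (in prob_space) integrable_bounded:
  fixes f :: "'a \<Rightarrow> 'b :: {banach, second_countable_topology}"
  assumes "f \<in> borel_measurable M" "\<And>x. norm (f x) \<le> B"
  shows "integrable M f"
  by (rule integrable_const_bound[of _ B]) (use assms in auto)

text \<open>Centred normal laws are kept as images of the standard one under \<open>v * z\<close>,
  which still makes sense for \<open>v = 0\<close>; \<open>normal_density 0 0\<close> is identically
  0.\<close>

lemma real_distribution_scaled_normal:
  "real_distribution (distr std_normal_distribution borel (\<lambda>z. v * z))"
proof -
  interpret real_distribution std_normal_distribution by (rule real_dist_normal_dist)
  show ?thesis by (rule real_distribution_distr) simp
qed

lemma char_scaled_normal:
  "char (distr std_normal_distribution borel (\<lambda>z. v * z)) s = of_real (exp (- (v\<^sup>2 * s\<^sup>2) / 2))"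
proof -
  have "char (distr std_normal_distribution borel (\<lambda>z. v * z)) s = char std_normal_distribution (s * v)"
    unfolding char_eq_cis by (subst integral_distr) (simp_all add: mult.assoc)
  then show ?thesis by (simp add: char_std_normal_distribution power_mult_distrib mult.commute)
qed

text \<open>Uniqueness of characteristic functions, applied to the law of \<open>D\<close> under the density \<open>w / c\<close>.\<close>

lemma (in prob_space) weighted_integral_eq:
  fixes D w :: "'a \<Rightarrow> real" and f :: "real \<Rightarrow> 'b :: {banach, second_countable_topology}"
  assumes [measurable]: "D \<in> borel_measurable M" "w \<in> borel_measurable M" "f \<in> borel_measurable borel"
    and w: "\<And>x. 0 \<le> w x" "\<And>x. w x \<le> B" and c: "c > 0" and M': "real_distribution M'"
    and ch: "\<And>s. (CLINT x|M. w x *\<^sub>R cis (s * D x)) = c *\<^sub>R char M' s"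
  shows "(\<integral>x. w x *\<^sub>R f (D x) \<partial>M) = c *\<^sub>R (\<integral>x. f x \<partial>M')"
proof -
  interpret M': real_distribution M' by (rule M')
  define d where "d = density M (\<lambda>x. w x / c)"
  have wc: "0 \<le> w x / c" for x using w c by simp
  have iw: "integrable M w" by (rule integrable_bounded[of _ B]) (use w in auto)
  \<comment> \<open>At s = 0 the hypothesis \<open>ch\<close> says that \<open>w\<close> has mean
    \<open>c\<close>, so that \<open>d\<close> is a probability measure.\<close>
  have "(CLINT x|M. complex_of_real (w x)) = c"
    using ch[of 0] M'.char_zero by (simp add: scaleR_conv_of_real)
  then have "(\<integral>x. w x \<partial>M) = c" by simp
  then have "(\<integral>\<^sup>+x. ennreal (w x / c) \<partial>M) = 1"
    using iw c w by (subst nn_integral_eq_integral) auto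
  then have pd: "prob_space d"
    unfolding d_def by (intro prob_spaceI) (simp add: emeasure_density cong: nn_integral_cong)
  interpret d: prob_space d by (rule pd)
  have [measurable]: "D \<in> borel_measurable d" by (simp add: d_def)
  have rd: "real_distribution (distr d borel D)" by (rule d.real_distribution_distr) simp
  have int: "(\<integral>x. g x \<partial>distr d borel D) = (1 / c) *\<^sub>R (\<integral>x. w x *\<^sub>R g (D x) \<partial>M)"
    if [measurable]: "g \<in> borel_measurable borel" for g :: "real \<Rightarrow> 'c :: {banach, second_countable_topology}"
  proof -
    have "(\<integral>x. g x \<partial>distr d borel D) = (\<integral>x. (w x / c) *\<^sub>R g (D x) \<partial>M)"
      unfolding d_def by (subst integral_distr, simp, simp, subst integral_density) (auto simp: wc)
    also have "\<dots> = (\<integral>x. (1 / c) *\<^sub>R (w x *\<^sub>R g (D x)) \<partial>M)" by simp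
    finally show ?thesis by (simp only: integral_scaleR_right)
  qed
  have "char (distr d borel D) = char M'"
  proof
    fix s
    have "char (distr d borel D) s = (1 / c) *\<^sub>R (c *\<^sub>R char M' s)"
      unfolding char_eq_cis[of "distr d borel D"] by (subst int) (simp_all add: ch)
    then show "char (distr d borel D) s = char M' s" using c by simp
  qed
  then have "distr d borel D = M'" by (rule Levy_uniqueness[OF rd M'])
  then show ?thesis using int[of f] c by simp
qed

lemma (in prob_space) distr_eq_scaled_normal:
  fixes X :: "'a \<Rightarrow> real"
  assumes "X \<in> borel_measurable M"
    and "\<And>s. (CLINT x|M. cis (s * X x)) = of_real (exp (- (v\<^sup>2 * s\<^sup>2) / 2))"
  shows "distr M borel X = distr std_normal_distribution borel (\<lambda>z. v * z)"
proof (rule Levy_uniqueness)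
  show "real_distribution (distr M borel X)" using assms(1) by (rule real_distribution_distr)
  show "char (distr M borel X) = char (distr std_normal_distribution borel (\<lambda>z. v * z))"
    using assms by (auto simp: char_distr_eq_cis char_scaled_normal)
qed (rule real_distribution_scaled_normal)

lemma (in prob_space) scaled_normal_moments:
  fixes X :: "'a \<Rightarrow> real" and f :: "real \<Rightarrow> real"
  assumes X: "X \<in> borel_measurable M"
    and d: "distr M borel X = distr std_normal_distribution borel (\<lambda>z. v * z)"
    and f: "f \<in> borel_measurable borel"
  shows "(\<integral>x. f (X x) \<partial>M) = (LINT z|std_normal_distribution. f (v * z))"
    and "integrable M (\<lambda>x. f (X x)) \<longleftrightarrow> integrable std_normal_distribution (\<lambda>z. f (v * z))"
proof -
  show "(\<integral>x. f (X x) \<partial>M) = (LINT z|std_normal_distribution. f (v * z))"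
    using integral_distr[OF X f] unfolding d by (subst (asm) integral_distr) (use f in auto)
  show "integrable M (\<lambda>x. f (X x)) \<longleftrightarrow> integrable std_normal_distribution (\<lambda>z. f (v * z))"
    using integrable_distr_eq[OF X f] unfolding d by (subst (asm) integrable_distr_eq) (use f in auto)
qed

lemma tendsto_times_sin_inverse: "(\<lambda>n. real (Suc n) * sin (y / real (Suc n))) \<longlonglongrightarrow> y"
proof (cases y "0::real" rule: linorder_cases)
  case equal then show ?thesis by simp
qed real_asymp+

text \<open>The factored characteristic function encodes independent centred normal variables with
  variances t^2 and e^2. It can be read off \<open>normal_law\<close> directly and admits
  \<open>e = 0\<close>.\<close>

locale normal_pair = prob_space +
  fixes D Y :: "'a \<Rightarrow> real" and t e :: real
  assumes D [measurable]: "D \<in> borel_measurable M" and Y [measurable]: "Y \<in> borel_measurable M"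
    and t: "0 < t"
    and joint: "\<And>s r. (CLINT x|M. cis (s * D x + r * Y x)) = of_real (exp (- (t\<^sup>2 * s\<^sup>2 + e\<^sup>2 * r\<^sup>2) / 2))"
begin

lemma distr_D: "distr M borel D = distr std_normal_distribution borel (\<lambda>z. t * z)"
  using joint[of _ 0] by (intro distr_eq_scaled_normal) simp_all

lemma distr_Y: "distr M borel Y = distr std_normal_distribution borel (\<lambda>z. e * z)"
  using joint[of 0] by (intro distr_eq_scaled_normal) simp_all

text \<open>The case s = r of \<open>joint\<close>. \<open>D + Y\<close> is the limit of the
  rescaled \<open>bC\<close>; its second moment and the limit law for a fixed gap come from
  here.\<close>

lemma distr_sum:
  "distr M borel (\<lambda>x. D x + Y x) = distr std_normal_distribution borel (\<lambda>z. sqrt (t\<^sup>2 + e\<^sup>2) * z)"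
  using joint by (intro distr_eq_scaled_normal) (simp_all add: ring_distribs)

lemmas D_moments = scaled_normal_moments[OF D distr_D]
lemmas Y_moments = scaled_normal_moments[OF Y distr_Y]

lemma D_integral:
  fixes f :: "real \<Rightarrow> 'b :: {banach, second_countable_topology}"
  assumes "f \<in> borel_measurable borel"
  shows "(\<integral>x. f (D x) \<partial>M) = (\<integral>z. f (t * z) \<partial>std_normal_distribution)"
  using integral_distr[OF D assms] unfolding distr_D by (subst (asm) integral_distr) (use assms in auto)

lemma integrable_cis_joint: "integrable M (\<lambda>x. cis (s * D x + r * Y x))"
  by (rule integrable_bounded[of _ 1]) auto

text \<open>Cosine and sine are half the sum and half the difference of \<open>joint\<close> at r
  and -r, up to a unit factor, and the right side of \<open>joint\<close> is even in r.\<close>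

lemma joint_trig:
  fixes s r :: real
  shows "(CLINT x|M. cos (r * Y x) *\<^sub>R cis (s * D x)) = of_real (exp (- (t\<^sup>2 * s\<^sup>2 + e\<^sup>2 * r\<^sup>2) / 2))"
    and "(CLINT x|M. sin (r * Y x) *\<^sub>R cis (s * D x)) = 0"
proof -
  have i: "integrable M (\<lambda>x. cis (s * D x + r * Y x))" "integrable M (\<lambda>x. cis (s * D x + (- r) * Y x))"
    by (rule integrable_cis_joint)+
  have c: "cos (r * Y x) *\<^sub>R cis (s * D x) = (1/2) * (cis (s * D x + r * Y x) + cis (s * D x + (- r) * Y x))" for x
    by (simp add: complex_eq_iff cos_add sin_add cos_diff sin_diff)
  have d: "sin (r * Y x) *\<^sub>R cis (s * D x) = (- \<i> / 2) * (cis (s * D x + r * Y x) - cis (s * D x + (- r) * Y x))" for x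
    by (simp add: complex_eq_iff cos_add sin_add cos_diff sin_diff)
  show "(CLINT x|M. cos (r * Y x) *\<^sub>R cis (s * D x)) = of_real (exp (- (t\<^sup>2 * s\<^sup>2 + e\<^sup>2 * r\<^sup>2) / 2))"
    unfolding c using i
    by (simp only: integral_mult_right_zero Bochner_Integration.integral_add joint) simp
  show "(CLINT x|M. sin (r * Y x) *\<^sub>R cis (s * D x)) = 0"
    unfolding d using i
    by (simp only: integral_mult_right_zero Bochner_Integration.integral_diff joint) simp
qed

text \<open>
  Independence of \<open>D\<close> and \<open>Y\<close>, in the form needed here. It comes from the one-dimensional uniqueness
  theorem with weights \<open>1 + cos (r Y)\<close> and \<open>1 + sin (r Y)\<close>, which are nonnegative.
\<close>

lemma joint_bounded:
  fixes f :: "real \<Rightarrow> 'b :: {banach, second_countable_topology}"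
  assumes f [measurable]: "f \<in> borel_measurable borel" and B: "\<And>x. norm (f x) \<le> B"
  shows "(\<integral>x. cos (r * Y x) *\<^sub>R f (D x) \<partial>M) = exp (- (e\<^sup>2 * r\<^sup>2) / 2) *\<^sub>R (\<integral>z. f (t * z) \<partial>std_normal_distribution)"
    and "(\<integral>x. sin (r * Y x) *\<^sub>R f (D x) \<partial>M) = 0"
proof -
  define M' where "M' = distr std_normal_distribution borel (\<lambda>z. t * z)"
  have M': "real_distribution M'" unfolding M'_def by (rule real_distribution_scaled_normal)
  have B0: "0 \<le> B" using B[of 0] norm_ge_zero order_trans by blast
  have nB: "\<bar>a\<bar> * norm (f y) \<le> B" if "\<bar>a\<bar> \<le> 1" for a y
    using mult_mono[OF that B[of y]] B0 by simp
  have if0: "integrable M (\<lambda>x. f (D x))" by (rule integrable_bounded[of _ B]) (auto simp: B)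
  have ic: "integrable M (\<lambda>x. cos (r * Y x) *\<^sub>R f (D x))"
    by (rule integrable_bounded[of _ B]) (auto intro: nB)
  have isn: "integrable M (\<lambda>x. sin (r * Y x) *\<^sub>R f (D x))"
    by (rule integrable_bounded[of _ B]) (auto intro: nB)
  have c0: "integrable M (\<lambda>x. cis (s * D x))" for s using integrable_cis_joint[of s 0] by simp
  have c1: "integrable M (\<lambda>x. cos (r * Y x) *\<^sub>R cis (s * D x))" for s
    by (rule integrable_bounded[of _ 1]) auto
  have c2: "integrable M (\<lambda>x. sin (r * Y x) *\<^sub>R cis (s * D x))" for s
    by (rule integrable_bounded[of _ 1]) auto
  have j0: "(CLINT x|M. cis (s * D x)) = of_real (exp (- (t\<^sup>2 * s\<^sup>2) / 2))" for s
    using joint[of s 0] by simp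
  have chM': "char M' s = of_real (exp (- (t\<^sup>2 * s\<^sup>2) / 2))" for s
    unfolding M'_def by (rule char_scaled_normal)
  have M'f: "(\<integral>x. f x \<partial>M') = (\<integral>z. f (t * z) \<partial>std_normal_distribution)"
    unfolding M'_def by (subst integral_distr) auto
  have Df: "(\<integral>x. f (D x) \<partial>M) = (\<integral>z. f (t * z) \<partial>std_normal_distribution)"
    by (rule D_integral) simp
  have "(\<integral>x. (1 + cos (r * Y x)) *\<^sub>R f (D x) \<partial>M) = (1 + exp (- (e\<^sup>2 * r\<^sup>2) / 2)) *\<^sub>R (\<integral>x. f x \<partial>M')"
  proof (rule weighted_integral_eq[where B=2])
    fix s
    have ex: "exp (- (t\<^sup>2 * s\<^sup>2 + e\<^sup>2 * r\<^sup>2) / 2) = exp (- (e\<^sup>2 * r\<^sup>2) / 2) * exp (- (t\<^sup>2 * s\<^sup>2) / 2)"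
      unfolding exp_add[symmetric] by (simp add: field_simps)
    have "(CLINT x|M. (1 + cos (r * Y x)) *\<^sub>R cis (s * D x))
        = (CLINT x|M. cis (s * D x)) + (CLINT x|M. cos (r * Y x) *\<^sub>R cis (s * D x))"
      unfolding scaleR_add_left scaleR_one by (rule Bochner_Integration.integral_add[OF c0 c1])
    also have "\<dots> = (1 + exp (- (e\<^sup>2 * r\<^sup>2) / 2)) *\<^sub>R char M' s"
      unfolding j0 joint_trig chM'
      unfolding ex by (simp add: scaleR_conv_of_real ring_distribs del: of_real_exp)
    finally show "(CLINT x|M. (1 + cos (r * Y x)) *\<^sub>R cis (s * D x)) = (1 + exp (- (e\<^sup>2 * r\<^sup>2) / 2)) *\<^sub>R char M' s" .
  next
    show "0 \<le> 1 + cos (r * Y x)" for x using cos_ge_minus_one[of "r * Y x"] by linarith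
    show "0 < 1 + exp (- (e\<^sup>2 * r\<^sup>2) / 2)" by (simp add: add_pos_pos)
  qed (use M' in auto)
  \<comment> \<open>Cancelling the unweighted mean \<open>Df\<close> removes the 1 from the
    weight.\<close>
  then show "(\<integral>x. cos (r * Y x) *\<^sub>R f (D x) \<partial>M) = exp (- (e\<^sup>2 * r\<^sup>2) / 2) *\<^sub>R (\<integral>z. f (t * z) \<partial>std_normal_distribution)"
    unfolding scaleR_add_left scaleR_one
    by (simp only: Bochner_Integration.integral_add[OF if0 ic] Df M'f add_left_cancel)
  have "(\<integral>x. (1 + sin (r * Y x)) *\<^sub>R f (D x) \<partial>M) = 1 *\<^sub>R (\<integral>x. f x \<partial>M')"
  proof (rule weighted_integral_eq[where B=2])
    fix s
    have "(CLINT x|M. (1 + sin (r * Y x)) *\<^sub>R cis (s * D x))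
        = (CLINT x|M. cis (s * D x)) + (CLINT x|M. sin (r * Y x) *\<^sub>R cis (s * D x))"
      unfolding scaleR_add_left scaleR_one by (rule Bochner_Integration.integral_add[OF c0 c2])
    also have "\<dots> = 1 *\<^sub>R char M' s"
      unfolding j0 joint_trig chM' by simp
    finally show "(CLINT x|M. (1 + sin (r * Y x)) *\<^sub>R cis (s * D x)) = 1 *\<^sub>R char M' s" .
  next
    show "0 \<le> 1 + sin (r * Y x)" for x using sin_ge_minus_one[of "r * Y x"] by linarith
  qed (use M' in auto)
  then show "(\<integral>x. sin (r * Y x) *\<^sub>R f (D x) \<partial>M) = 0"
    unfolding scaleR_add_left scaleR_one
    by (simp only: Bochner_Integration.integral_add[OF if0 isn] Df M'f) simp
qed

lemma integrable_D: "integrable M D" and integrable_Y: "integrable M Y"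
proof -
  have m: "(\<lambda>x::real. x) \<in> borel_measurable borel" by measurable
  have i: "integrable std_normal_distribution (\<lambda>z. c * z)" for c :: real
    by (intro integrable_mult_right std_normal_first_moment(1))
  show "integrable M D" by (rule D_moments(2)[OF m, THEN iffD2, OF i])
  show "integrable M Y" by (rule Y_moments(2)[OF m, THEN iffD2, OF i])
qed

text \<open>This removes the cross term between \<open>Y\<close> and the correction from the second
  moment of the limit, so that the excess risk involves \<open>D\<close> alone.\<close>

lemma orthogonal_bounded:
  fixes f :: "real \<Rightarrow> real"
  assumes f [measurable]: "f \<in> borel_measurable borel" and B: "\<And>x. \<bar>f x\<bar> \<le> B"
  shows "integrable M (\<lambda>x. Y x * f (D x))" and "(\<integral>x. Y x * f (D x) \<partial>M) = 0"
proof -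
  have iB: "integrable M (\<lambda>x. B * \<bar>Y x\<bar>)"
    by (intro integrable_mult_right integrable_abs integrable_Y)
  have bd: "\<bar>y * f x\<bar> \<le> B * \<bar>z\<bar>" if "\<bar>y\<bar> \<le> \<bar>z\<bar>" for x y z
    using mult_mono[OF that B[of x]] by (simp add: abs_mult mult.commute)
  \<comment> \<open>\<open>Y\<close> is the dominated limit of \<open>n sin (Y / n)\<close>\<close>
  define g where "g n x = real (Suc n) * sin (Y x / real (Suc n)) * f (D x)" for n x
  have gb: "norm (g n x) \<le> B * \<bar>Y x\<bar>" for n x
  proof -
    have "\<bar>real (Suc n)\<bar> * \<bar>sin (Y x / real (Suc n))\<bar> \<le> real (Suc n) * \<bar>Y x / real (Suc n)\<bar>"
      unfolding abs_of_nat by (rule mult_left_mono[OF abs_sin_x_le_abs_x of_nat_0_le_iff])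
    also have "\<dots> = \<bar>Y x\<bar>" by (simp add: abs_divide)
    finally have "\<bar>real (Suc n) * sin (Y x / real (Suc n))\<bar> \<le> \<bar>Y x\<bar>" by (simp add: abs_mult)
    then show ?thesis unfolding g_def real_norm_def by (rule bd)
  qed
  have gl: "(\<lambda>n. g n x) \<longlonglongrightarrow> Y x * f (D x)" for x
    unfolding g_def by (intro tendsto_mult tendsto_times_sin_inverse tendsto_const)
  have [measurable]: "g n \<in> borel_measurable M" for n unfolding g_def by measurable
  have "(\<integral>x. g n x \<partial>M) = 0" for n
  proof -
    have "(\<integral>x. g n x \<partial>M) = real (Suc n) * (\<integral>x. sin ((1 / real (Suc n)) * Y x) *\<^sub>R f (D x) \<partial>M)"
      unfolding g_def by (simp add: mult.assoc del: of_nat_Suc)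
    also have "\<dots> = 0" using joint_bounded(2)[OF f, of B "1 / real (Suc n)"] B by simp
    finally show ?thesis .
  qed
  moreover have "(\<lambda>n. \<integral>x. g n x \<partial>M) \<longlonglongrightarrow> (\<integral>x. Y x * f (D x) \<partial>M)"
    by (rule integral_dominated_convergence[OF _ _ iB]) (auto intro: gl gb[unfolded real_norm_def])
  ultimately have "(\<lambda>n::nat. 0) \<longlonglongrightarrow> (\<integral>x. Y x * f (D x) \<partial>M)" by simp
  then show "(\<integral>x. Y x * f (D x) \<partial>M) = 0" by (simp add: LIMSEQ_const_iff)
  show "integrable M (\<lambda>x. Y x * f (D x))"
  proof (rule Bochner_Integration.integrable_bound[OF iB])
    show "AE x in M. norm (Y x * f (D x)) \<le> norm (B * \<bar>Y x\<bar>)"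
      by (rule AE_I2) (metis bd abs_ge_self order_refl order_trans real_norm_def)
  qed simp
qed

text \<open>This is $X + t^2 (h - D) / ((h - D)^2 + t^2)$ with $X = D + Y$.\<close>

definition mse_limit :: "real \<Rightarrow> 'a \<Rightarrow> real" where
  "mse_limit h x = D x + Y x + t * shrink (h / t - D x / t)"

lemma mse_limit_measurable [measurable]: "mse_limit h \<in> borel_measurable M"
  unfolding mse_limit_def by measurable

text \<open>The right side mentions only t, e and h, so any two normal pairs with the same
  parameters give the same limit law. The factor for \<open>Y\<close> splits off by writing cis (s
  Y) as cosine plus i times sine and using \<open>joint_bounded\<close>.\<close>

lemma char_mse_limit:
  "char (distr M borel (mse_limit h)) s =
     of_real (exp (- (e\<^sup>2 * s\<^sup>2) / 2)) * (CLINT z|std_normal_distribution. cis (s * (t * z + t * shrink (h / t - z))))"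
proof -
  define f where "f d = cis (s * (d + t * shrink (h / t - d / t)))" for d
  have [measurable]: "f \<in> borel_measurable borel" unfolding f_def by measurable
  have fb: "norm (f d) \<le> 1" for d by (simp add: f_def)
  have b: "\<bar>a\<bar> * norm (f d) \<le> 1" if "\<bar>a\<bar> \<le> 1" for a d
    using that by (simp add: f_def)
  have i: "integrable M (\<lambda>x. cos (s * Y x) *\<^sub>R f (D x))" "integrable M (\<lambda>x. sin (s * Y x) *\<^sub>R f (D x))"
    by (rule integrable_bounded[of _ 1]; auto intro: b)+
  have "cis (s * mse_limit h x) = cos (s * Y x) *\<^sub>R f (D x) + \<i> * (sin (s * Y x) *\<^sub>R f (D x))" for x
  proof -
    have "cis (s * mse_limit h x) = cis (s * Y x) * f (D x)"
      unfolding mse_limit_def f_def cis_mult by (simp add: algebra_simps)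
    then show ?thesis by (simp add: complex_eq_iff)
  qed
  then have "char (distr M borel (mse_limit h)) s
      = (CLINT x|M. cos (s * Y x) *\<^sub>R f (D x) + \<i> * (sin (s * Y x) *\<^sub>R f (D x)))"
    by (simp add: char_distr_eq_cis)
  also have "\<dots> = (CLINT x|M. cos (s * Y x) *\<^sub>R f (D x)) + \<i> * (CLINT x|M. sin (s * Y x) *\<^sub>R f (D x))"
    using i by (simp only: Bochner_Integration.integral_add integrable_mult_right integral_mult_right_zero)
  also have "\<dots> = exp (- (e\<^sup>2 * s\<^sup>2) / 2) *\<^sub>R (CLINT z|std_normal_distribution. f (t * z))"
    using joint_bounded[of f 1 s] fb by simp
  finally show ?thesis using t unfolding f_def by (simp add: scaleR_conv_of_real)
qed

section \<open>Moments of the limit variable\<close>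

lemma correction_bounded: "\<bar>t * shrink w\<bar> \<le> t"
  using abs_shrink_le[of w] t by (simp add: abs_mult)

text \<open>Expand the square of (D + Y) + G (D). The first square gives t^2 + e^2, the product with
  \<open>Y\<close> has mean 0, and the substitution d = t z turns the other two terms into t^2 times
  the integrals of \<open>std_normal_shrinkage_risk\<close>.\<close>

lemma mse_limit_second_moment:
  "integrable M (\<lambda>x. (mse_limit h x)\<^sup>2)"
  "expectation (\<lambda>x. (mse_limit h x)\<^sup>2) = t\<^sup>2 + e\<^sup>2 + t\<^sup>2 * mean_excess_risk (h / t)"
proof -
  define k where "k = h / t"
  define G where "G d = t * shrink (k - d / t)" for d
  have [measurable]: "G \<in> borel_measurable borel" unfolding G_def by measurable
  have Gb: "\<bar>G d\<bar> \<le> t" for d unfolding G_def by (rule correction_bounded)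
  have tz: "t \<noteq> 0" using t by simp
  note sm = scaled_normal_moments[OF _ distr_sum, of "\<lambda>x. x\<^sup>2"]
  have i1: "integrable M (\<lambda>x. (D x + Y x)\<^sup>2)"
    using sm(2) std_normal_second_moment(1) by (simp add: power_mult_distrib)
  have e1: "(\<integral>x. (D x + Y x)\<^sup>2 \<partial>M) = t\<^sup>2 + e\<^sup>2"
    using sm(1) std_normal_second_moment(2) by (simp add: power_mult_distrib)
  have DG: "t * z * G (t * z) = t\<^sup>2 * (z * shrink (k - z))" for z
    by (simp add: G_def tz power2_eq_square)
  have i2: "integrable M (\<lambda>x. D x * G (D x))"
    using D_moments(2)[of "\<lambda>d. d * G d"] std_normal_shrinkage_risk(2)[of k]
    by (simp add: DG)
  have e2: "(\<integral>x. D x * G (D x) \<partial>M) = t\<^sup>2 * (LINT z|std_normal_distribution. z * shrink (k - z))"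
    using D_moments(1)[of "\<lambda>d. d * G d"] by (simp add: DG)
  have i3: "integrable M (\<lambda>x. (G (D x))\<^sup>2)"
    using D_moments(2)[of "\<lambda>d. (G d)\<^sup>2"] std_normal_shrinkage_risk(3)[of k]
    by (simp add: G_def tz power_mult_distrib)
  have e3: "(\<integral>x. (G (D x))\<^sup>2 \<partial>M) = t\<^sup>2 * (LINT z|std_normal_distribution. (shrink (k - z))\<^sup>2)"
    using D_moments(1)[of "\<lambda>d. (G d)\<^sup>2"] by (simp add: G_def tz power_mult_distrib)
  note i4 = orthogonal_bounded(1)[of G t] and e4 = orthogonal_bounded(2)[of G t]
  have U: "(mse_limit h x)\<^sup>2 = (D x + Y x)\<^sup>2 + 2 * (D x * G (D x)) + 2 * (Y x * G (D x)) + (G (D x))\<^sup>2" for x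
    unfolding mse_limit_def G_def k_def by (simp add: power2_eq_square algebra_simps)
  show "integrable M (\<lambda>x. (mse_limit h x)\<^sup>2)"
    unfolding U using i1 i2 i3 i4 Gb by simp
  have "expectation (\<lambda>x. (mse_limit h x)\<^sup>2) = t\<^sup>2 + e\<^sup>2
      + 2 * (t\<^sup>2 * (LINT z|std_normal_distribution. z * shrink (k - z)))
      + t\<^sup>2 * (LINT z|std_normal_distribution. (shrink (k - z))\<^sup>2)"
    unfolding U using i1 i2 i3 i4 e4 Gb by (simp add: e1 e2 e3)
  also have "\<dots> = t\<^sup>2 + e\<^sup>2 + t\<^sup>2 * mean_excess_risk k"
  proof -
    have *: "mean_excess_risk k = 2 * (LINT z|std_normal_distribution. z * shrink (k - z)) + (LINT z|std_normal_distribution. (shrink (k - z))\<^sup>2)"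
      using std_normal_shrinkage_risk[of k] by simp
    show ?thesis unfolding * distrib_left mult.left_commute[of 2] add.assoc ..
  qed
  finally show "expectation (\<lambda>x. (mse_limit h x)\<^sup>2) = t\<^sup>2 + e\<^sup>2 + t\<^sup>2 * mean_excess_risk (h / t)"
    unfolding k_def .
qed

text \<open>At h = 0 the variable is an odd function of \<open>D\<close> plus \<open>Y\<close>, and
  both summands have mean 0.\<close>

lemma mse_limit_0_mean: "expectation (mse_limit 0) = 0"
proof -
  define f where "f d = d + t * shrink (0 / t - d / t)" for d
  have [measurable]: "f \<in> borel_measurable borel" unfolding f_def by measurable
  have "integrable M (\<lambda>x. t * shrink (0 / t - D x / t))"
    by (rule integrable_bounded[of _ t]) (auto simp: correction_bounded[simplified])
  then have i: "integrable M (\<lambda>x. f (D x))" unfolding f_def using integrable_D by simp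
  have "(\<integral>x. f (D x) \<partial>M) = (LINT z|std_normal_distribution. f (t * z))"
    by (rule D_moments(1)) simp
  also have "\<dots> = 0"
    by (rule std_normal_integral_symmetric) (simp add: f_def shrink_def)
  finally have 1: "(\<integral>x. f (D x) \<partial>M) = 0" .
  have 2: "(\<integral>x. Y x \<partial>M) = 0"
    using Y_moments(1)[of "\<lambda>x. x"] std_normal_first_moment(2) by simp
  have "expectation (mse_limit 0) = (\<integral>x. f (D x) + Y x \<partial>M)"
    unfolding mse_limit_def f_def by (simp add: algebra_simps)
  also have "\<dots> = 0" using i integrable_Y by (simp add: 1 2)
  finally show ?thesis .
qed

lemma mse_limit_0_variance: "variance (mse_limit 0) \<in> {e\<^sup>2 <..< t\<^sup>2 + e\<^sup>2}"
proof -
  have "variance (mse_limit 0) = t\<^sup>2 + e\<^sup>2 + t\<^sup>2 * mean_excess_risk 0"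
    unfolding mse_limit_0_mean using mse_limit_second_moment(2)[of 0] by simp
  moreover have "t\<^sup>2 * mean_excess_risk 0 < 0" "t\<^sup>2 * (-1) < t\<^sup>2 * mean_excess_risk 0"
    using mean_excess_risk_0 t by (simp_all only: mult_less_cancel_left_pos zero_less_power mult_pos_neg)
  ultimately show ?thesis by simp
qed

end

lemma scaled_normal_eq_density:
  assumes "0 < v"
  shows "distr std_normal_distribution borel (\<lambda>z. v * z) = density lborel (normal_density 0 v)"
proof -
  interpret real_distribution std_normal_distribution by (rule real_dist_normal_dist)
  have "distr std_normal_distribution lborel (\<lambda>x. x) = distr std_normal_distribution std_normal_distribution (\<lambda>x. x)"
    by (rule distr_cong) simp_all
  then have "distributed std_normal_distribution lborel (\<lambda>x. x) std_normal_density"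
    unfolding distributed_def by simp
  from normal_density_affine[OF this, of v 0] assms
  have "distributed std_normal_distribution lborel (\<lambda>x. v * x) (normal_density 0 v)"
    by simp
  then have "distr std_normal_distribution lborel (\<lambda>x. v * x) = density lborel (normal_density 0 v)"
    by (rule distributed_distr_eq_density)
  moreover have "distr std_normal_distribution lborel (\<lambda>x. v * x) = distr std_normal_distribution borel (\<lambda>x. v * x)"
    by (rule distr_cong) simp_all
  ultimately show ?thesis by simp
qed

text \<open>The covariance equals the variance of the second coordinate, so the quadratic form has
  no mixed term in the coordinates s and r.\<close>

lemma normal_pair_of_normal_law:
  fixes N :: "(real^2) measure"
  assumes "0 \<le> e2" "e2 < c2" and N: "normal_law 0 (vector [vector [c2, e2], vector [e2, e2]]) N"
  shows "normal_pair N (\<lambda>x. x $ 1 - x $ 2) (\<lambda>x. x $ 2) (sqrt (c2 - e2)) (sqrt e2)"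
proof -
  have sets: "sets N = sets (borel :: (real^2) measure)" and prob: "prob_space N"
    using N by (auto simp: normal_law_def)
  have m: "(\<lambda>x. x $ i) \<in> borel_measurable N" for i :: 2
    unfolding measurable_cong_sets[OF sets refl]
    by (intro borel_measurable_continuous_onI continuous_intros)
  have "(CLINT x|N. cis (s * (x $ 1 - x $ 2) + r * x $ 2))
      = of_real (exp (- ((sqrt (c2 - e2))\<^sup>2 * s\<^sup>2 + (sqrt e2)\<^sup>2 * r\<^sup>2) / 2))" for s r :: real
  proof -
    \<comment> \<open>The coefficients of s (x1 - x2) + r x2 with respect to x1 and x2.\<close>
    define u :: "real^2" where "u = vector [s, r - s]"
    have "(CLINT x|N. cis (u \<bullet> x)) = exp (- complex_of_real (u \<bullet> (vector [vector [c2, e2], vector [e2, e2]] *v u)) / 2)"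
      using N by (simp add: normal_law_def flip: cis_zero)
    also have "u \<bullet> (vector [vector [c2, e2], vector [e2, e2]] *v u) = (c2 - e2) * s\<^sup>2 + e2 * r\<^sup>2"
      by (simp add: u_def inner_vec_def sum_2 matrix_vector_mult_def power2_eq_square algebra_simps)
    also have "(\<lambda>x. cis (u \<bullet> x)) = (\<lambda>x. cis (s * (x $ 1 - x $ 2) + r * x $ 2))"
      by (simp add: u_def inner_vec_def sum_2 algebra_simps)
    finally show ?thesis using assms(1,2) by (simp flip: exp_of_real)
  qed
  with m prob assms(2) show ?thesis
    unfolding normal_pair_def normal_pair_axioms_def by simp
qed

section \<open>The estimator as a measurable function\<close>

lemma emp_mse_quadratic:
  "emp_mse bC bE vC vE c p = ((bE - bC)\<^sup>2 + (vE + vC - 2 * c)) * p\<^sup>2 - 2 * (vC - c) * p + vC"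
  unfolding emp_mse_def by (simp add: algebra_simps power2_eq_square)

text \<open>Measurability of the estimator must hold on the whole sample space, also where the
  denominator is not positive. There \<open>arg_min\<close> can take only two fixed values,
  according to whether every p or no p is a minimiser.\<close>

lemma p_hat_cases:
  "p_hat bC bE vC vE c =
    (if 0 < (bE - bC)\<^sup>2 + (vE + vC - 2 * c) then (vC - c) / ((bE - bC)\<^sup>2 + (vE + vC - 2 * c))
     else if (bE - bC)\<^sup>2 + (vE + vC - 2 * c) = 0 \<and> vC - c = 0 then (SOME p. True) else (SOME p. False))"
proof -
  define d where "d = (bE - bC)\<^sup>2 + (vE + vC - 2 * c)"
  define a where "a = vC - c"
  have q: "emp_mse bC bE vC vE c p = d * p\<^sup>2 - 2 * a * p + vC" for p
    unfolding emp_mse_quadratic d_def a_def ..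
  have min: "is_arg_min (emp_mse bC bE vC vE c) (\<lambda>_. True) p
      \<longleftrightarrow> (\<forall>s. 0 \<le> d * s\<^sup>2 + 2 * (d * p - a) * s)" for p
  proof -
    have e: "emp_mse bC bE vC vE c (p + s) - emp_mse bC bE vC vE c p = d * s\<^sup>2 + 2 * (d * p - a) * s" for s
      unfolding q by (simp add: algebra_simps power2_eq_square)
    have "is_arg_min (emp_mse bC bE vC vE c) (\<lambda>_. True) p
        \<longleftrightarrow> (\<forall>y. emp_mse bC bE vC vE c p \<le> emp_mse bC bE vC vE c y)"
      by (auto simp: is_arg_min_def not_less)
    also have "\<dots> \<longleftrightarrow> (\<forall>s. 0 \<le> emp_mse bC bE vC vE c (p + s) - emp_mse bC bE vC vE c p)"
      by (metis add_diff_cancel_left' diff_add_cancel diff_ge_0_iff_ge add.commute)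
    finally show ?thesis unfolding e .
  qed
  have neg: "\<not> is_arg_min (emp_mse bC bE vC vE c) (\<lambda>_. True) p" if "\<not> 0 < d" "\<not> (d = 0 \<and> a = 0)" for p
  proof
    assume "is_arg_min (emp_mse bC bE vC vE c) (\<lambda>_. True) p"
    then have m: "0 \<le> d * s\<^sup>2 + 2 * (d * p - a) * s" for s unfolding min by blast
    \<comment> \<open>Adding the inequalities for s = 1 and s = -1 gives 0 <= d. With d = 0 the
      condition is linear in s, and s = a refutes it unless a = 0.\<close>
    have "d = 0" using m[of 1] m[of "-1"] that(1) by simp
    then have "0 \<le> - 2 * (a * a)" using m[of a] by simp
    then have "a = 0" using zero_le_square[of a] by simp
    with \<open>d = 0\<close> that(2) show False by blast
  qed
  consider "0 < d" | "d = 0" "a = 0" | "\<not> 0 < d" "\<not> (d = 0 \<and> a = 0)" by blast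
  then show ?thesis
  proof cases
    case 1 then show ?thesis using p_hat_eq[of bE bC vE vC c] by (simp add: d_def)
  next
    case 2
    then have "is_arg_min (emp_mse bC bE vC vE c) (\<lambda>_. True) = (\<lambda>p. True)" unfolding min by simp
    then show ?thesis using 2 unfolding p_hat_def arg_min_def d_def a_def by simp
  next
    case 3
    then have "is_arg_min (emp_mse bC bE vC vE c) (\<lambda>_. True) = (\<lambda>p. False)" using neg by blast
    then show ?thesis using 3 unfolding p_hat_def arg_min_def d_def a_def by auto
  qed
qed

lemma borel_measurable_beta_MSE [measurable]:
  assumes [measurable]: "bC \<in> borel_measurable M" "bE \<in> borel_measurable M" "vC \<in> borel_measurable M"
    "vE \<in> borel_measurable M" "c \<in> borel_measurable M"
  shows "(\<lambda>\<omega>. beta_MSE (bC \<omega>) (bE \<omega>) (vC \<omega>) (vE \<omega>) (c \<omega>)) \<in> borel_measurable M"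
  unfolding beta_MSE_def p_hat_cases by measurable

section \<open>Weak convergence\<close>

lemma norm_cis_diff_le: "norm (cis a - cis b) \<le> \<bar>a - b\<bar>"
proof -
  have "cis a - cis b = cis b * (cis (a - b) - 1)"
    by (simp add: cis_mult algebra_simps)
  then have "norm (cis a - cis b) = norm (cis (a - b) - 1)"
    by (simp add: norm_mult)
  also have "\<dots> \<le> \<bar>a - b\<bar>"
    using iexp_approx1[of "a - b" 0] by (simp add: cis_conv_exp)
  finally show ?thesis .
qed

lemma norm_cis_diff_le_2: "norm (cis a - cis b) \<le> 2"
  using norm_triangle_ineq4[of "cis a" "cis b"] by simp

text \<open>Slutsky's lemma at the level of characteristic functions: cis is Lipschitz and bounded,
  so an error that vanishes in probability does not change the limit.\<close>

lemma weak_conv_of_char_of_close: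
  fixes T S :: "nat \<Rightarrow> 'a \<Rightarrow> real"
  assumes M: "\<And>n. prob_space (M n)"
    and T: "\<And>n. T n \<in> borel_measurable (M n)" and S: "\<And>n. S n \<in> borel_measurable (M n)"
    and close: "conv_in_prob M (\<lambda>n \<omega>. T n \<omega> - S n \<omega>) 0"
    and L: "real_distribution L"
    and ch: "\<And>s. (\<lambda>n. CLINT \<omega>|M n. cis (s * S n \<omega>)) \<longlonglongrightarrow> char L s"
  shows "weak_conv_m (\<lambda>n. distr (M n) borel (T n)) L"
proof (rule levy_continuity[OF _ L])
  note [measurable] = T S
  show "real_distribution (distr (M n) borel (T n))" for n
    by (rule prob_space.real_distribution_distr[OF M T])
  fix s :: real
  have "(\<lambda>n. (CLINT \<omega>|M n. cis (s * T n \<omega>)) - (CLINT \<omega>|M n. cis (s * S n \<omega>))) \<longlonglongrightarrow> 0"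
    unfolding tendsto_iff
  proof (intro allI impI)
    fix r :: real assume r: "r > 0"
    \<comment> \<open>Off \<open>A n\<close> the integrand is at most |s| d <= r / 2, where the 1
      covers s = 0; on \<open>A n\<close> it is at most 2, which contributes less than 2 * (r /
      4).\<close>
    define d where "d = r / (2 * (\<bar>s\<bar> + 1))"
    have d: "d > 0" unfolding d_def using r by simp
    have sd: "\<bar>s\<bar> * d \<le> r / 2"
    proof -
      have "\<bar>s\<bar> * d \<le> (\<bar>s\<bar> + 1) * d" using d by simp
      also have "\<dots> = r / 2" unfolding d_def by (simp add: divide_simps)
      finally show ?thesis .
    qed
    define A where "A n = {\<omega> \<in> space (M n). dist (T n \<omega> - S n \<omega>) 0 > d}" for n
    have A: "A n \<in> sets (M n)" for n unfolding A_def by measurable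
    have "(\<lambda>n. measure (M n) (A n)) \<longlonglongrightarrow> 0"
      using close d unfolding conv_in_prob_def A_def by simp
    then have "\<forall>\<^sub>F n in sequentially. measure (M n) (A n) < r / 4"
      using r by (intro order_tendstoD(2)[of _ 0]) auto
    then show "\<forall>\<^sub>F n in sequentially. dist ((CLINT \<omega>|M n. cis (s * T n \<omega>)) - (CLINT \<omega>|M n. cis (s * S n \<omega>))) 0 < r"
    proof eventually_elim
      case (elim n)
      interpret prob_space "M n" by (rule M)
      have i: "integrable (M n) (\<lambda>\<omega>. cis (s * T n \<omega>))" "integrable (M n) (\<lambda>\<omega>. cis (s * S n \<omega>))"
        by (rule integrable_bounded[of _ 1]; simp)+
      have iA: "integrable (M n) (\<lambda>\<omega>. \<bar>s\<bar> * d + 2 * indicator (A n) \<omega>)"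
        using A[of n] by (intro integrable_bounded[of _ "\<bar>s\<bar> * d + 2"]) (use d in \<open>auto simp: indicator_def\<close>)
      have "norm (\<integral>\<omega>. cis (s * T n \<omega>) - cis (s * S n \<omega>) \<partial>M n) \<le> (\<integral>\<omega>. norm (cis (s * T n \<omega>) - cis (s * S n \<omega>)) \<partial>M n)"
        by (rule integral_norm_bound)
      also have "\<dots> \<le> (\<integral>\<omega>. \<bar>s\<bar> * d + 2 * indicator (A n) \<omega> \<partial>M n)"
      proof (rule integral_mono)
        fix \<omega> assume w: "\<omega> \<in> space (M n)"
        show "norm (cis (s * T n \<omega>) - cis (s * S n \<omega>)) \<le> \<bar>s\<bar> * d + 2 * indicator (A n) \<omega>"
        proof (cases "\<omega> \<in> A n")
          case True
          have "0 \<le> \<bar>s\<bar> * d" using d by simp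
          with norm_cis_diff_le_2[of "s * T n \<omega>" "s * S n \<omega>"] True show ?thesis by simp
        next
          case False
          then have "\<bar>T n \<omega> - S n \<omega>\<bar> \<le> d" using w by (simp add: A_def)
          then have "\<bar>s\<bar> * \<bar>T n \<omega> - S n \<omega>\<bar> \<le> \<bar>s\<bar> * d" by (rule mult_left_mono) simp
          with norm_cis_diff_le[of "s * T n \<omega>" "s * S n \<omega>"] False show ?thesis
            by (simp flip: abs_mult right_diff_distrib)
        qed
      qed (use i iA in auto)
      also have "(\<integral>\<omega>. \<bar>s\<bar> * d + 2 * indicator (A n) \<omega> \<partial>M n) = \<bar>s\<bar> * d + 2 * measure (M n) (A n)"
      proof -
        have "integrable (M n) (\<lambda>\<omega>. indicator (A n) \<omega> :: real)"
          using A[of n] by (intro integrable_bounded[of _ 1]) (auto simp: indicator_def)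
        then show ?thesis
          using A[of n] by (subst Bochner_Integration.integral_add) (auto simp: prob_space)
      qed
      also have "\<dots> < r" using sd elim r by argo
      finally show ?case using i by (simp add: dist_norm)
    qed
  qed
  from tendsto_add[OF this ch[of s]]
  show "(\<lambda>n. char (distr (M n) borel (T n)) s) \<longlonglongrightarrow> char L s"
    by (simp add: char_distr_eq_cis T)
qed

lemma (in prob_space) integral_cis:
  fixes f :: "'a \<Rightarrow> real"
  assumes [measurable]: "f \<in> borel_measurable M"
  shows "(CLINT x|M. cis (f x)) = Complex (\<integral>x. cos (f x) \<partial>M) (\<integral>x. sin (f x) \<partial>M)"
proof -
  have "integrable M (\<lambda>x. cis (f x))" by (rule integrable_bounded[of _ 1]) auto
  from integral_Re[OF this] integral_Im[OF this] show ?thesis by (simp add: complex_eq_iff)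
qed

text \<open>\<open>conv_in_distr\<close> tests real functions only, so the cosine and the sine of s
  f are tested separately and recombined.\<close>

lemma conv_in_distr_char:
  fixes f :: "'b :: {metric_space} \<Rightarrow> real"
  assumes M: "\<And>n. prob_space (M n)" and N: "prob_space N" "sets N = sets borel"
    and W: "conv_in_distr M W N" and f: "continuous_on UNIV f"
    and m: "\<And>n. (\<lambda>\<omega>. f (W n \<omega>)) \<in> borel_measurable (M n)"
  shows "(\<lambda>n. CLINT \<omega>|M n. cis (s * f (W n \<omega>))) \<longlonglongrightarrow> char (distr N borel f) s"
proof -
  have fm: "f \<in> borel_measurable N"
    unfolding measurable_cong_sets[OF N(2) refl] using f by (rule borel_measurable_continuous_onI)
  have b: "bounded (range (\<lambda>x. cos (s * f x)))" "bounded (range (\<lambda>x. sin (s * f x)))"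
    by (auto simp: bounded_iff intro!: exI[of _ 1])
  have "(\<lambda>n. \<integral>\<omega>. cos (s * f (W n \<omega>)) \<partial>M n) \<longlonglongrightarrow> (\<integral>x. cos (s * f x) \<partial>N)"
    using W b(1) continuous_on_cos[OF continuous_on_mult_left[OF f, of s]] unfolding conv_in_distr_def by blast
  moreover have "(\<lambda>n. \<integral>\<omega>. sin (s * f (W n \<omega>)) \<partial>M n) \<longlonglongrightarrow> (\<integral>x. sin (s * f x) \<partial>N)"
    using W b(2) continuous_on_sin[OF continuous_on_mult_left[OF f, of s]] unfolding conv_in_distr_def by blast
  ultimately show ?thesis
    using m fm unfolding char_distr_eq_cis[OF fm]
    by (simp add: prob_space.integral_cis[OF M] prob_space.integral_cis[OF N(1)] tendsto_Complex)
qed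

text \<open>Bundles several deviations into one null sequence, so that later estimates refer to a
  single exceptional event.\<close>

lemma conv_in_prob_abs_add:
  fixes X Y :: "nat \<Rightarrow> 'a \<Rightarrow> real"
  assumes M: "\<And>n. prob_space (M n)"
    and [measurable]: "\<And>n. X n \<in> borel_measurable (M n)" "\<And>n. Y n \<in> borel_measurable (M n)"
    and X: "conv_in_prob M X x" and Y: "conv_in_prob M Y y"
  shows "conv_in_prob M (\<lambda>n \<omega>. \<bar>X n \<omega> - x\<bar> + \<bar>Y n \<omega> - y\<bar>) 0"
  unfolding conv_in_prob_def
proof (intro allI impI)
  fix e :: real assume e: "e > 0"
  define A where "A n = {\<omega> \<in> space (M n). dist (X n \<omega>) x > e / 2}" for n
  define B where "B n = {\<omega> \<in> space (M n). dist (Y n \<omega>) y > e / 2}" for n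
  have [measurable]: "A n \<in> sets (M n)" "B n \<in> sets (M n)" for n
    unfolding A_def B_def by measurable
  have "(\<lambda>n. measure (M n) (A n)) \<longlonglongrightarrow> 0" "(\<lambda>n. measure (M n) (B n)) \<longlonglongrightarrow> 0"
    unfolding A_def B_def using X Y half_gt_zero[OF e] unfolding conv_in_prob_def by blast+
  from tendsto_add[OF this] have *: "(\<lambda>n. measure (M n) (A n) + measure (M n) (B n)) \<longlonglongrightarrow> 0" by simp
  show "(\<lambda>n. measure (M n) {\<omega> \<in> space (M n). dist (\<bar>X n \<omega> - x\<bar> + \<bar>Y n \<omega> - y\<bar>) 0 > e}) \<longlonglongrightarrow> 0"
  proof (rule Lim_null_comparison[OF always_eventually *], rule allI)
    fix n
    interpret prob_space "M n" by (rule M)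
    have "measure (M n) {\<omega> \<in> space (M n). dist (\<bar>X n \<omega> - x\<bar> + \<bar>Y n \<omega> - y\<bar>) 0 > e} \<le> measure (M n) (A n \<union> B n)"
      by (rule finite_measure_mono) (auto simp: A_def B_def dist_real_def)
    also have "\<dots> \<le> measure (M n) (A n) + measure (M n) (B n)"
      by (rule measure_Un_le) measurable
    finally show "norm (measure (M n) {\<omega> \<in> space (M n). dist (\<bar>X n \<omega> - x\<bar> + \<bar>Y n \<omega> - y\<bar>) 0 > e})
      \<le> measure (M n) (A n) + measure (M n) (B n)" by simp
  qed
qed

text \<open>Turns a deterministic implication, valid for large n, into convergence in probability by
  inclusion of the exceptional events.\<close>

lemma conv_in_prob_dominated:
  fixes R T :: "nat \<Rightarrow> 'a \<Rightarrow> real"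
  assumes M: "\<And>n. prob_space (M n)" and [measurable]: "\<And>n. R n \<in> borel_measurable (M n)"
    and R: "conv_in_prob M R 0"
    and le: "\<And>e. 0 < e \<Longrightarrow> \<exists>d>0. \<forall>\<^sub>F n in sequentially. \<forall>\<omega>\<in>space (M n). \<bar>R n \<omega>\<bar> \<le> d \<longrightarrow> \<bar>T n \<omega>\<bar> \<le> e"
  shows "conv_in_prob M T 0"
  unfolding conv_in_prob_def
proof (intro allI impI)
  fix e :: real assume "e > 0"
  from le[OF this] obtain d where d: "d > 0"
    and ev: "\<forall>\<^sub>F n in sequentially. \<forall>\<omega>\<in>space (M n). \<bar>R n \<omega>\<bar> \<le> d \<longrightarrow> \<bar>T n \<omega>\<bar> \<le> e" by blast
  have *: "(\<lambda>n. measure (M n) {\<omega> \<in> space (M n). dist (R n \<omega>) 0 > d}) \<longlonglongrightarrow> 0"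
    using R d unfolding conv_in_prob_def by simp
  show "(\<lambda>n. measure (M n) {\<omega> \<in> space (M n). dist (T n \<omega>) 0 > e}) \<longlonglongrightarrow> 0"
  proof (rule Lim_null_comparison[OF _ *])
    show "\<forall>\<^sub>F n in sequentially. norm (measure (M n) {\<omega> \<in> space (M n). dist (T n \<omega>) 0 > e})
        \<le> measure (M n) {\<omega> \<in> space (M n). dist (R n \<omega>) 0 > d}"
      using ev
    proof eventually_elim
      case (elim n)
      interpret prob_space "M n" by (rule M)
      have "measure (M n) {\<omega> \<in> space (M n). dist (T n \<omega>) 0 > e} \<le> measure (M n) {\<omega> \<in> space (M n). dist (R n \<omega>) 0 > d}"
        by (rule finite_measure_mono) (use elim in \<open>auto simp: not_le[symmetric]\<close>)
      then show ?case by simp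
    qed
  qed
qed

text \<open>A sequence that converges in distribution is tight, so dividing it by \<open>sqrt n\<close> makes it vanish.\<close>

lemma conv_in_prob_of_scaled_conv_in_distr:
  fixes g :: "'b :: metric_space \<Rightarrow> real" and Q :: "nat \<Rightarrow> 'a \<Rightarrow> real"
  assumes M: "\<And>n. prob_space (M n)" and N: "prob_space N" "sets N = sets borel"
    and W: "conv_in_distr M W N" and g: "continuous_on UNIV g"
    and [measurable]: "\<And>n. (\<lambda>\<omega>. g (W n \<omega>)) \<in> borel_measurable (M n)"
    and Q: "\<And>n \<omega>. g (W n \<omega>) = sqrt (real n) * Q n \<omega>"
  shows "conv_in_prob M Q 0"
  unfolding conv_in_prob_def tendsto_iff
proof (intro allI impI)
  fix e r :: real assume e: "e > 0" and r: "r > 0"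
  \<comment> \<open>A continuous cutoff, admissible as a test function: 0 where |g| <= K and 1 where
    |g| >= K + 1.\<close>
  define f where "f K x = min 1 (max 0 (\<bar>g x\<bar> - K))" for K x
  have gm [measurable]: "g \<in> borel_measurable N"
    unfolding measurable_cong_sets[OF N(2) refl] using g by (rule borel_measurable_continuous_onI)
  have cf: "continuous_on UNIV (f K)" for K unfolding f_def by (intro continuous_intros g)
  have f01: "0 \<le> f K x" "f K x \<le> 1" for K x by (auto simp: f_def)
  interpret N: prob_space N by (rule N(1))
  have "(\<lambda>k. \<integral>x. f (real k) x \<partial>N) \<longlonglongrightarrow> (\<integral>x. 0 \<partial>N)"
  proof (rule integral_dominated_convergence[where w="\<lambda>_. 1"])
    show "AE x in N. (\<lambda>k. f (real k) x) \<longlonglongrightarrow> 0"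
    proof (rule AE_I2)
      fix x
      obtain k0 where "\<bar>g x\<bar> \<le> real k0" using real_arch_simple by blast
      then have "\<forall>\<^sub>F k in sequentially. f (real k) x = 0"
        unfolding eventually_sequentially by (intro exI[of _ k0]) (auto simp: f_def)
      then show "(\<lambda>k. f (real k) x) \<longlonglongrightarrow> 0" by (rule tendsto_eventually)
    qed
  qed (use f01 in \<open>auto simp: f_def\<close>)
  then have "\<forall>\<^sub>F k in sequentially. (\<integral>x. f (real k) x \<partial>N) < r"
    using r by (intro order_tendstoD(2)) auto
  then obtain k where k: "(\<integral>x. f (real k) x \<partial>N) < r"
    by (auto simp: eventually_sequentially)
  have "bounded (range (f (real k)))"
    using f01 by (auto simp: bounded_iff intro!: exI[of _ 1])
  then have "(\<lambda>n. \<integral>\<omega>. f (real k) (W n \<omega>) \<partial>M n) \<longlonglongrightarrow> (\<integral>x. f (real k) x \<partial>N)"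
    using W cf unfolding conv_in_distr_def by blast
  then have 1: "\<forall>\<^sub>F n in sequentially. (\<integral>\<omega>. f (real k) (W n \<omega>) \<partial>M n) < r"
    using k by (rule order_tendstoD(2))
  have "filterlim (\<lambda>n. sqrt (real n) * e) at_top sequentially"
    using e by real_asymp
  then have 2: "\<forall>\<^sub>F n in sequentially. real k + 1 \<le> sqrt (real n) * e"
    by (simp add: filterlim_at_top)
  from 1 2 show "\<forall>\<^sub>F n in sequentially. dist (measure (M n) {\<omega> \<in> space (M n). dist (Q n \<omega>) 0 > e}) 0 < r"
  proof eventually_elim
    case (elim n)
    interpret prob_space "M n" by (rule M)
    define A where "A = {\<omega> \<in> space (M n). real k + 1 \<le> \<bar>g (W n \<omega>)\<bar>}"
    have A: "A \<in> sets (M n)" unfolding A_def by measurable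
    have "measure (M n) {\<omega> \<in> space (M n). dist (Q n \<omega>) 0 > e} \<le> measure (M n) A"
    proof (rule finite_measure_mono[OF _ A], safe)
      fix \<omega> assume w: "\<omega> \<in> space (M n)" "e < dist (Q n \<omega>) 0"
      have "sqrt (real n) * e \<le> sqrt (real n) * \<bar>Q n \<omega>\<bar>" using w by (intro mult_left_mono) auto
      then show "\<omega> \<in> A" using elim(2) w(1) unfolding A_def Q by (simp add: abs_mult)
    qed
    also have "\<dots> = (\<integral>\<omega>. indicator A \<omega> \<partial>M n)" using A by simp
    also have "\<dots> \<le> (\<integral>\<omega>. f (real k) (W n \<omega>) \<partial>M n)"
    proof (rule integral_mono)
      show "integrable (M n) (\<lambda>\<omega>. indicator A \<omega> :: real)"
        using A by (intro integrable_bounded[of _ 1]) (auto simp: indicator_def)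
      have "(\<lambda>\<omega>. f (real k) (W n \<omega>)) \<in> borel_measurable (M n)" unfolding f_def by measurable
      then show "integrable (M n) (\<lambda>\<omega>. f (real k) (W n \<omega>))"
        by (rule integrable_bounded[of _ 1]) (use f01 in auto)
      show "indicator A \<omega> \<le> f (real k) (W n \<omega>)" if "\<omega> \<in> space (M n)" for \<omega>
        using f01 by (auto simp: indicator_def A_def f_def)
    qed
    also have "\<dots> < r" by (rule elim(1))
    finally show ?case by simp
  qed
qed


section \<open>Limit laws of the estimation error\<close>

text \<open>The bound is uniform in w, which is random and not bounded. The numerator of the
  difference is at most 2 d q times |w|, which cancels q, and |w| / p <= 1 / t by the
  arithmetic-geometric mean inequality, since d <= t^2 / 2 keeps b >= t^2 / 2.\<close>

lemma shrinkage_diff_le: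
  fixes t w a b d :: real
  assumes t: "0 < t" and d: "d \<le> t\<^sup>2 / 2" and a: "\<bar>a - t\<^sup>2\<bar> \<le> d" and b: "\<bar>b - t\<^sup>2\<bar> \<le> d"
  shows "0 < w\<^sup>2 + b" "\<bar>w * (a / (w\<^sup>2 + b)) - t * shrink (w / t)\<bar> \<le> 2 * d / t"
proof -
  define p q where "p = w\<^sup>2 + b" and "q = w\<^sup>2 + t\<^sup>2"
  have t2: "0 < t\<^sup>2" using t by simp
  have q: "0 < q" unfolding q_def using t2 by (simp add: add_nonneg_pos)
  have d0: "0 \<le> d" using a by simp
  have pb: "w\<^sup>2 + t\<^sup>2 / 2 \<le> p" using b d unfolding p_def by argo
  then show p: "0 < w\<^sup>2 + b" using t2 zero_le_power2[of w] unfolding p_def by linarith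
  have wp: "t * \<bar>w\<bar> \<le> p"
  proof -
    have "0 \<le> (\<bar>w\<bar> - t)\<^sup>2" by simp
    then have "2 * (t * \<bar>w\<bar>) \<le> w\<^sup>2 + t\<^sup>2" by (simp add: power2_diff mult.commute)
    then show ?thesis using pb zero_le_power2[of w] by linarith
  qed
  have "t * shrink (w / t) = t\<^sup>2 * w / q"
    using t q unfolding shrink_def q_def by (simp add: divide_simps power2_eq_square)
  moreover have "w * (a / p) - t\<^sup>2 * w / q = w * (((a - t\<^sup>2) * w\<^sup>2 + t\<^sup>2 * (a - b)) / q) / p"
  proof -
    have "w * a * q - t\<^sup>2 * w * p = w * ((a - t\<^sup>2) * w\<^sup>2 + t\<^sup>2 * (a - b))"
      unfolding p_def q_def by (simp add: algebra_simps)
    then show ?thesis using p q unfolding p_def[symmetric] by (simp add: divide_simps)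
  qed
  ultimately have eq: "w * (a / p) - t * shrink (w / t) = w * (((a - t\<^sup>2) * w\<^sup>2 + t\<^sup>2 * (a - b)) / q) / p" by simp
  have ab: "\<bar>a - b\<bar> \<le> 2 * d" using a b by linarith
  have "\<bar>(a - t\<^sup>2) * w\<^sup>2 + t\<^sup>2 * (a - b)\<bar> \<le> \<bar>a - t\<^sup>2\<bar> * w\<^sup>2 + t\<^sup>2 * \<bar>a - b\<bar>"
    by (rule order_trans[OF abs_triangle_ineq]) (simp add: abs_mult)
  also have "\<dots> \<le> d * w\<^sup>2 + t\<^sup>2 * (2 * d)"
    by (intro add_mono mult_right_mono mult_left_mono a ab) auto
  also have "\<dots> \<le> 2 * d * q" unfolding q_def using d0 by (simp add: algebra_simps)
  finally have N: "\<bar>((a - t\<^sup>2) * w\<^sup>2 + t\<^sup>2 * (a - b)) / q\<bar> \<le> 2 * d"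
    using q by (simp add: abs_divide pos_divide_le_eq)
  have "\<bar>w * (a / p) - t * shrink (w / t)\<bar> = \<bar>w\<bar> * \<bar>((a - t\<^sup>2) * w\<^sup>2 + t\<^sup>2 * (a - b)) / q\<bar> / p"
    unfolding eq using p unfolding p_def by (simp add: abs_mult abs_divide)
  also have "\<dots> \<le> \<bar>w\<bar> * (2 * d) / p"
    using N p unfolding p_def by (intro divide_right_mono mult_left_mono) auto
  also have "\<dots> \<le> 2 * d / t"
  proof -
    have "(t * \<bar>w\<bar>) * (2 * d) \<le> p * (2 * d)" using wp d0 by (intro mult_right_mono) auto
    then show ?thesis using t p unfolding p_def by (simp add: divide_simps mult_ac)
  qed
  finally show "\<bar>w * (a / (w\<^sup>2 + b)) - t * shrink (w / t)\<bar> \<le> 2 * d / t" unfolding p_def .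
qed

text \<open>Numerator and denominator of the weight are both multiplied by n, which brings in
  exactly the quantities whose limits are known.\<close>

lemma scaled_beta_MSE_error:
  fixes bC bE vC vE c b0 :: real and n :: nat
  defines "w \<equiv> sqrt (real n) * (bE - bC)"
  assumes n: "1 \<le> n" and pos: "0 < w\<^sup>2 + real n * (vE + vC - 2 * c)"
  shows "sqrt (real n) * (beta_MSE bC bE vC vE c - b0) =
    sqrt (real n) * (bC - b0) + w * ((real n * (vC - c)) / (w\<^sup>2 + real n * (vE + vC - 2 * c)))"
proof -
  define d where "d = (bE - bC)\<^sup>2 + (vE + vC - 2 * c)"
  have d: "w\<^sup>2 + real n * (vE + vC - 2 * c) = real n * d"
    unfolding w_def d_def by (simp add: power_mult_distrib distrib_left)
  then have "0 < d" using pos n by (simp add: zero_less_mult_iff)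
  then have "p_hat bC bE vC vE c = (vC - c) / d" unfolding d_def by (rule p_hat_eq)
  then have p: "real n * (vC - c) / (real n * d) = p_hat bC bE vC vE c" using n by simp
  show ?thesis
    unfolding d p beta_MSE_def unfolding w_def by (simp add: algebra_simps)
qed

text \<open>The shape of \<open>R\<close> is the literal result of applying
  \<open>conv_in_prob_abs_add\<close> twice. The rescaled numerator and the variance part of the
  denominator have the same limit c2 - e2; the factor 2 absorbs the term 2 c.\<close>

lemma estimator_seq_deviation:
  assumes "estimator_seq c2 e2 M bC bE vC vE c beta0 betaE"
  defines "R \<equiv> \<lambda>n \<omega>. \<bar>real n * vC n \<omega> - c2\<bar> + \<bar>(\<bar>real n * vE n \<omega> - e2\<bar> + \<bar>real n * c n \<omega> - e2\<bar>) - 0\<bar>"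
  shows "conv_in_prob M R 0" "R n \<in> borel_measurable (M n)"
    "\<bar>real n * (vC n \<omega> - c n \<omega>) - (c2 - e2)\<bar> \<le> 2 * R n \<omega>"
    "\<bar>real n * (vE n \<omega> + vC n \<omega> - 2 * c n \<omega>) - (c2 - e2)\<bar> \<le> 2 * R n \<omega>"
proof -
  have M: "prob_space (M n)" and [measurable]: "vC n \<in> borel_measurable (M n)" "vE n \<in> borel_measurable (M n)"
    "c n \<in> borel_measurable (M n)" for n
    using assms(1) unfolding estimator_seq_def by auto
  show "conv_in_prob M R 0"
    unfolding R_def
    using assms(1) unfolding estimator_seq_def by (intro conv_in_prob_abs_add M) auto
  show "R n \<in> borel_measurable (M n)" unfolding R_def by measurable
  define x y z where "x = real n * vC n \<omega> - c2" and "y = real n * vE n \<omega> - e2" and "z = real n * c n \<omega> - e2"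
  have r: "R n \<omega> = \<bar>x\<bar> + \<bar>y\<bar> + \<bar>z\<bar>" unfolding R_def x_def y_def z_def by simp
  have "real n * (vC n \<omega> - c n \<omega>) - (c2 - e2) = x - z"
    unfolding x_def z_def by (simp add: algebra_simps)
  then show "\<bar>real n * (vC n \<omega> - c n \<omega>) - (c2 - e2)\<bar> \<le> 2 * R n \<omega>"
    unfolding r using abs_triangle_ineq4[of x z] abs_ge_zero[of x] abs_ge_zero[of y] abs_ge_zero[of z] by argo
  have e: "real n * (vE n \<omega> + vC n \<omega> - 2 * c n \<omega>) - (c2 - e2) = y + x - 2 * z"
    unfolding x_def y_def z_def by (simp add: algebra_simps)
  have "\<bar>y + x - 2 * z\<bar> \<le> 2 * (\<bar>x\<bar> + \<bar>y\<bar> + \<bar>z\<bar>)" by argo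
  then show "\<bar>real n * (vE n \<omega> + vC n \<omega> - 2 * c n \<omega>) - (c2 - e2)\<bar> \<le> 2 * R n \<omega>"
    unfolding r e .
qed

text \<open>\<open>mse_limit\<close> depends on D, Y and t but not on the measure, so the limit
  variable is one fixed function on the plane for all witnesses of the normal law.\<close>

abbreviation mse_limit2 :: "real \<Rightarrow> real \<Rightarrow> real \<Rightarrow> real^2 \<Rightarrow> real" where
  "mse_limit2 c2 e2 \<equiv> normal_pair.mse_limit (\<lambda>x. x $ 1 - x $ 2) (\<lambda>x. x $ 2) (sqrt (c2 - e2))"

text \<open>
  The limit is stated for an arbitrary \<open>N0\<close> with the right characteristic function, because for
  different \<open>h\<close> the hypotheses may provide different witnesses.
\<close>

lemma mse_error_law_weak_conv_local:
  assumes v: "0 \<le> e2" "e2 < c2"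
    and E: "estimator_seq c2 e2 M bC bE vC vE c beta0 betaE"
    and h: "\<forall>n\<ge>1. betaE n = beta0 n + h / sqrt (real n)"
    and N0: "normal_law 0 (vector [vector [c2, e2], vector [e2, e2]]) N0"
  shows "weak_conv_m (mse_error_law M bC bE vC vE c beta0) (distr N0 borel (mse_limit2 c2 e2 h))"
proof -
  define t where "t = sqrt (c2 - e2)"
  have t: "0 < t" and t2: "t\<^sup>2 = c2 - e2" using v unfolding t_def by auto
  interpret N0: normal_pair N0 "\<lambda>x. x $ 1 - x $ 2" "\<lambda>x. x $ 2" t "sqrt e2"
    unfolding t_def by (rule normal_pair_of_normal_law[OF v N0])
  have M: "prob_space (M n)" and [measurable]: "bC n \<in> borel_measurable (M n)" "bE n \<in> borel_measurable (M n)"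
      "vC n \<in> borel_measurable (M n)" "vE n \<in> borel_measurable (M n)" "c n \<in> borel_measurable (M n)" for n
    using E unfolding estimator_seq_def by auto
  define W where "W n \<omega> = (sqrt (real n) *\<^sub>R vector [bC n \<omega> - beta0 n, bE n \<omega> - betaE n] :: real^2)" for n \<omega>
  obtain N where N: "normal_law 0 (vector [vector [c2, e2], vector [e2, e2]]) N" and W: "conv_in_distr M W N"
    using E unfolding estimator_seq_def W_def by blast
  interpret N: normal_pair N "\<lambda>x. x $ 1 - x $ 2" "\<lambda>x. x $ 2" t "sqrt e2"
    unfolding t_def by (rule normal_pair_of_normal_law[OF v N])
  have W1: "W n \<omega> $ 1 = sqrt (real n) * (bC n \<omega> - beta0 n)" and W2: "W n \<omega> $ 2 = sqrt (real n) * (bE n \<omega> - betaE n)" for n \<omega>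
    unfolding W_def by simp_all
  define g where "g = N.mse_limit h"
  have g: "g x = x $ 1 + t * shrink ((h - (x $ 1 - x $ 2)) / t)" for x
    unfolding g_def N.mse_limit_def by (simp add: diff_divide_distrib)
  have cg: "continuous_on UNIV g"
    unfolding g using t by (intro continuous_intros continuous_on_compose2[OF continuous_shrink]) auto
  have gW [measurable]: "(\<lambda>\<omega>. g (W n \<omega>)) \<in> borel_measurable (M n)" for n
    unfolding g W1 W2 by measurable
  define T where "T n \<omega> = sqrt (real n) * (beta_MSE (bC n \<omega>) (bE n \<omega>) (vC n \<omega>) (vE n \<omega>) (c n \<omega>) - beta0 n)" for n \<omega>
  have Tm [measurable]: "T n \<in> borel_measurable (M n)" for n unfolding T_def by measurable
  note R = estimator_seq_deviation[OF E]
  have close: "conv_in_prob M (\<lambda>n \<omega>. T n \<omega> - g (W n \<omega>)) 0"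
  proof (rule conv_in_prob_dominated[OF M R(2) R(1)])
    fix e :: real assume e: "0 < e"
    \<comment> \<open>\<open>shrinkage_diff_le\<close> is applied with 2 * d: the first bound meets
      its side condition, the second makes its error at most e.\<close>
    define d where "d = min (t\<^sup>2 / 4) (e * t / 4)"
    have d: "0 < d" "2 * d \<le> t\<^sup>2 / 2" "2 * (2 * d) / t \<le> e"
      using e t unfolding d_def by (auto simp: pos_divide_le_eq)
    define R where "R n \<omega> = \<bar>real n * vC n \<omega> - c2\<bar> + \<bar>(\<bar>real n * vE n \<omega> - e2\<bar> + \<bar>real n * c n \<omega> - e2\<bar>) - 0\<bar>" for n \<omega>
    have "\<bar>T n \<omega> - g (W n \<omega>)\<bar> \<le> e" if n: "1 \<le> n" and r: "\<bar>R n \<omega>\<bar> \<le> d" for n \<omega>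
    proof -
      define w where "w = sqrt (real n) * (bE n \<omega> - bC n \<omega>)"
      have a: "\<bar>real n * (vC n \<omega> - c n \<omega>) - t\<^sup>2\<bar> \<le> 2 * d"
        and b: "\<bar>real n * (vE n \<omega> + vC n \<omega> - 2 * c n \<omega>) - t\<^sup>2\<bar> \<le> 2 * d"
        using R(3)[of n \<omega>] R(4)[of n \<omega>] r unfolding R_def[symmetric] t2 by linarith+
      note s = shrinkage_diff_le[OF t d(2) a b, of w]
      \<comment> \<open>Here 1 <= n matters: at n = 0 the left side is 0 and the right side is
        h.\<close>
      have hw: "w = h - (W n \<omega> $ 1 - W n \<omega> $ 2)"
        using n h unfolding w_def W1 W2 by (simp add: algebra_simps)
      have gw: "g (W n \<omega>) = sqrt (real n) * (bC n \<omega> - beta0 n) + t * shrink (w / t)"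
        unfolding g hw[symmetric] by (simp add: W1)
      have "T n \<omega> - g (W n \<omega>) = w * (real n * (vC n \<omega> - c n \<omega>) / (w\<^sup>2 + real n * (vE n \<omega> + vC n \<omega> - 2 * c n \<omega>))) - t * shrink (w / t)"
        unfolding T_def gw
        using scaled_beta_MSE_error[OF n, of "bE n \<omega>" "bC n \<omega>" "vE n \<omega>" "vC n \<omega>" "c n \<omega>" "beta0 n"] s(1)
        unfolding w_def by simp
      then show ?thesis using s(2) d(3) by linarith
    qed
    then show "\<exists>d>0. \<forall>\<^sub>F n in sequentially. \<forall>\<omega>\<in>space (M n).
        \<bar>\<bar>real n * vC n \<omega> - c2\<bar> + \<bar>(\<bar>real n * vE n \<omega> - e2\<bar> + \<bar>real n * c n \<omega> - e2\<bar>) - 0\<bar>\<bar> \<le> d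
        \<longrightarrow> \<bar>T n \<omega> - g (W n \<omega>)\<bar> \<le> e"
      unfolding R_def eventually_sequentially using d(1) by blast
  qed
  have "sets N = sets borel" using N by (simp add: normal_law_def)
  note ch = conv_in_distr_char[OF M N.prob_space_axioms this W cg gW]
  have "char (distr N borel g) = char (distr N0 borel (N.mse_limit h))"
    unfolding g_def by (rule ext) (simp only: N.char_mse_limit N0.char_mse_limit)
  with ch have ch': "(\<lambda>n. CLINT \<omega>|M n. cis (s * g (W n \<omega>))) \<longlonglongrightarrow> char (distr N0 borel (N.mse_limit h)) s" for s
    by simp
  have "weak_conv_m (\<lambda>n. distr (M n) borel (T n)) (distr N0 borel (N.mse_limit h))"
    by (rule weak_conv_of_char_of_close[OF M Tm gW close N0.real_distribution_distr[OF N0.mse_limit_measurable] ch'])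
  then show ?thesis unfolding T_def mse_error_law_def t_def .
qed

text \<open>With a fixed gap |w| grows like sqrt n, while the correction w a / (w^2 + b) is at most
  |a| / |w| for b >= 0. The rescaled \<open>bC\<close> alone survives in the limit.\<close>

lemma mse_error_law_weak_conv_fixed:
  assumes v: "0 \<le> e2" "e2 < c2"
    and E: "estimator_seq c2 e2 M bC bE vC vE c (\<lambda>n. b0) (\<lambda>n. bE0)" and ne: "b0 \<noteq> bE0"
  shows "weak_conv_m (mse_error_law M bC bE vC vE c (\<lambda>n. b0)) (density lborel (normal_density 0 (sqrt c2)))"
proof -
  define t where "t = sqrt (c2 - e2)"
  have t: "0 < t" and t2: "t\<^sup>2 = c2 - e2" using v unfolding t_def by auto
  define D where "D = \<bar>bE0 - b0\<bar>"
  have D: "0 < D" using ne unfolding D_def by simp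
  have M: "prob_space (M n)" and [measurable]: "bC n \<in> borel_measurable (M n)" "bE n \<in> borel_measurable (M n)"
      "vC n \<in> borel_measurable (M n)" "vE n \<in> borel_measurable (M n)" "c n \<in> borel_measurable (M n)" for n
    using E unfolding estimator_seq_def by auto
  define W where "W n \<omega> = (sqrt (real n) *\<^sub>R vector [bC n \<omega> - b0, bE n \<omega> - bE0] :: real^2)" for n \<omega>
  obtain N where N: "normal_law 0 (vector [vector [c2, e2], vector [e2, e2]]) N" and W: "conv_in_distr M W N"
    using E unfolding estimator_seq_def W_def by blast
  interpret N: normal_pair N "\<lambda>x. x $ 1 - x $ 2" "\<lambda>x. x $ 2" t "sqrt e2"
    unfolding t_def by (rule normal_pair_of_normal_law[OF v N])
  have sN: "sets N = sets borel" using N by (simp add: normal_law_def)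
  have W1: "W n \<omega> $ 1 = sqrt (real n) * (bC n \<omega> - b0)" and W2: "W n \<omega> $ 2 = sqrt (real n) * (bE n \<omega> - bE0)" for n \<omega>
    unfolding W_def by simp_all
  define Q where "Q n \<omega> = (bE n \<omega> - bC n \<omega>) - (bE0 - b0)" for n \<omega>
  have Qm: "Q n \<in> borel_measurable (M n)" for n unfolding Q_def by measurable
  have Q: "conv_in_prob M Q 0"
  proof (rule conv_in_prob_of_scaled_conv_in_distr[OF M N.prob_space_axioms sN W])
    show "continuous_on UNIV (\<lambda>x::real^2. x $ 2 - x $ 1)" by (intro continuous_intros)
    show "(\<lambda>\<omega>. W n \<omega> $ 2 - W n \<omega> $ 1) \<in> borel_measurable (M n)" for n unfolding W1 W2 by measurable
    show "W n \<omega> $ 2 - W n \<omega> $ 1 = sqrt (real n) * Q n \<omega>" for n \<omega>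
      unfolding W1 W2 Q_def by (simp add: algebra_simps)
  qed
  define R where "R n \<omega> = \<bar>real n * vC n \<omega> - c2\<bar> + \<bar>(\<bar>real n * vE n \<omega> - e2\<bar> + \<bar>real n * c n \<omega> - e2\<bar>) - 0\<bar>" for n \<omega>
  note R = estimator_seq_deviation[OF E, folded R_def]
  have R0: "0 \<le> R n \<omega>" for n \<omega> unfolding R_def by simp
  have RQ: "conv_in_prob M (\<lambda>n \<omega>. \<bar>R n \<omega> - 0\<bar> + \<bar>Q n \<omega> - 0\<bar>) 0"
    by (rule conv_in_prob_abs_add[OF M R(2) Qm R(1) Q])
  have RQm: "(\<lambda>\<omega>. \<bar>R n \<omega> - 0\<bar> + \<bar>Q n \<omega> - 0\<bar>) \<in> borel_measurable (M n)" for n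
    using R(2) Qm by measurable
  define T where "T n \<omega> = sqrt (real n) * (beta_MSE (bC n \<omega>) (bE n \<omega>) (vC n \<omega>) (vE n \<omega>) (c n \<omega>) - b0)" for n \<omega>
  have Tm: "T n \<in> borel_measurable (M n)" for n unfolding T_def by measurable
  have W1m: "(\<lambda>\<omega>. W n \<omega> $ 1) \<in> borel_measurable (M n)" for n unfolding W1 by measurable
  have close: "conv_in_prob M (\<lambda>n \<omega>. T n \<omega> - W n \<omega> $ 1) 0"
  proof (rule conv_in_prob_dominated[OF M RQm RQ])
    fix e :: real assume e: "0 < e"
    \<comment> \<open>The first term keeps the denominator positive and a bounded; the second keeps
      the observed distance at least half the true gap.\<close>
    define d where "d = min (t\<^sup>2 / 4) (D / 2)"
    have d: "0 < d" "2 * d \<le> t\<^sup>2 / 2" "d \<le> D / 2"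
      using D t unfolding d_def by auto
    have "filterlim (\<lambda>n. sqrt (real n) * (D / 2) * e) at_top sequentially"
      using D e by real_asymp
    \<comment> \<open>2 t^2 will bound |a| and sqrt n * (D / 2) will bound |w| from below, so this
      says |a| <= |w| e.\<close>
    then have "\<forall>\<^sub>F n in sequentially. 2 * t\<^sup>2 \<le> sqrt (real n) * (D / 2) * e"
      unfolding filterlim_at_top by blast
    with eventually_ge_at_top[of 1]
    have "\<forall>\<^sub>F n in sequentially. \<forall>\<omega>\<in>space (M n). \<bar>\<bar>R n \<omega> - 0\<bar> + \<bar>Q n \<omega> - 0\<bar>\<bar> \<le> d \<longrightarrow> \<bar>T n \<omega> - W n \<omega> $ 1\<bar> \<le> e"
    proof eventually_elim
      case (elim n)
      show ?case
      proof (intro ballI impI)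
        fix \<omega> assume "\<bar>\<bar>R n \<omega> - 0\<bar> + \<bar>Q n \<omega> - 0\<bar>\<bar> \<le> d"
        then have r: "R n \<omega> \<le> d" "\<bar>Q n \<omega>\<bar> \<le> d" using R0[of n \<omega>] by linarith+
        define w where "w = sqrt (real n) * (bE n \<omega> - bC n \<omega>)"
        define a where "a = real n * (vC n \<omega> - c n \<omega>)"
        define b where "b = real n * (vE n \<omega> + vC n \<omega> - 2 * c n \<omega>)"
        have a: "\<bar>a - t\<^sup>2\<bar> \<le> 2 * d" and b: "\<bar>b - t\<^sup>2\<bar> \<le> 2 * d"
          using R(3)[of n \<omega>] R(4)[of n \<omega>] r(1) unfolding t2 a_def b_def by linarith+
        have b0: "0 \<le> b" and a2: "\<bar>a\<bar> \<le> 2 * t\<^sup>2" using a b d(2) zero_le_power2[of t] by linarith+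
        note pos = shrinkage_diff_le(1)[OF t d(2) a b, of w]
        have "\<bar>bE0 - b0\<bar> \<le> \<bar>bE n \<omega> - bC n \<omega>\<bar> + \<bar>Q n \<omega>\<bar>" unfolding Q_def by linarith
        then have "D / 2 \<le> \<bar>bE n \<omega> - bC n \<omega>\<bar>" using r(2) d(3) unfolding D_def by argo
        then have "sqrt (real n) * (D / 2) \<le> sqrt (real n) * \<bar>bE n \<omega> - bC n \<omega>\<bar>"
          by (rule mult_left_mono) simp
        then have w: "sqrt (real n) * (D / 2) \<le> \<bar>w\<bar>"
          unfolding w_def abs_mult by simp
        have "0 < sqrt (real n) * (D / 2)" using elim(1) D by simp
        with w have w0: "0 < \<bar>w\<bar>" by linarith
        have "2 * t\<^sup>2 \<le> sqrt (real n) * (D / 2) * e" by (rule elim(2))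
        also have "\<dots> \<le> \<bar>w\<bar> * e" using w e by (intro mult_right_mono) auto
        finally have we: "2 * t\<^sup>2 \<le> \<bar>w\<bar> * e" .
        have "\<bar>w\<bar> * \<bar>a\<bar> \<le> \<bar>w\<bar> * (\<bar>w\<bar> * e)" using a2 we by (intro mult_left_mono) auto
        also have "\<dots> = w\<^sup>2 * e" by (simp add: power2_eq_square mult.assoc[symmetric] flip: abs_mult)
        also have "\<dots> \<le> (w\<^sup>2 + b) * e" using b0 e by (intro mult_right_mono) auto
        finally have "\<bar>w\<bar> * \<bar>a\<bar> / (w\<^sup>2 + b) \<le> e" using pos by (simp add: pos_divide_le_eq mult.commute)
        moreover have "T n \<omega> - W n \<omega> $ 1 = w * (a / (w\<^sup>2 + b))"
          unfolding T_def W1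
          using scaled_beta_MSE_error[OF elim(1), of "bE n \<omega>" "bC n \<omega>" "vE n \<omega>" "vC n \<omega>" "c n \<omega>" b0] pos
          unfolding w_def a_def b_def by simp
        ultimately show "\<bar>T n \<omega> - W n \<omega> $ 1\<bar> \<le> e" using pos by (simp add: abs_mult abs_divide)
      qed
    qed
    with d(1) show "\<exists>d>0. \<forall>\<^sub>F n in sequentially. \<forall>\<omega>\<in>space (M n). \<bar>\<bar>R n \<omega> - 0\<bar> + \<bar>Q n \<omega> - 0\<bar>\<bar> \<le> d \<longrightarrow> \<bar>T n \<omega> - W n \<omega> $ 1\<bar> \<le> e"
      by blast
  qed
  have "continuous_on UNIV (\<lambda>x::real^2. x $ 1)" by (intro continuous_intros)
  note ch = conv_in_distr_char[OF M N.prob_space_axioms sN W this W1m]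
  have te: "sqrt (t\<^sup>2 + (sqrt e2)\<^sup>2) = sqrt c2" using v t2 by simp
  have "distr N borel (\<lambda>x. x $ 1) = density lborel (normal_density 0 (sqrt c2))"
    using N.distr_sum v scaled_normal_eq_density[of "sqrt c2"] unfolding te by simp
  then have ch': "(\<lambda>n. CLINT \<omega>|M n. cis (s * W n \<omega> $ 1)) \<longlonglongrightarrow> char (density lborel (normal_density 0 (sqrt c2))) s" for s
    using ch by simp
  have L: "real_distribution (density lborel (normal_density 0 (sqrt c2)))"
    unfolding real_distribution_def real_distribution_axioms_def
    using v by (auto intro: prob_space_normal_density)
  have "weak_conv_m (\<lambda>n. distr (M n) borel (T n)) (density lborel (normal_density 0 (sqrt c2)))"
    by (rule weak_conv_of_char_of_close[OF M Tm W1m close L ch'])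
  then show ?thesis unfolding T_def mse_error_law_def .
qed

theorem theorem2p2:
  fixes sC2 sE2 :: real
  assumes "0 \<le> sE2" and "sE2 < sC2"
  shows
    "(\<forall>(M :: nat \<Rightarrow> 'a measure) bC bE vC vE cCE (b0 :: real) (bE0 :: real).
        estimator_seq sC2 sE2 M bC bE vC vE cCE (\<lambda>n. b0) (\<lambda>n. bE0) \<longrightarrow> b0 \<noteq> bE0 \<longrightarrow>
        weak_conv_m (mse_error_law M bC bE vC vE cCE (\<lambda>n. b0))
          (density lborel (normal_density 0 (sqrt sC2))))
     \<and>
     (\<forall>(M :: nat \<Rightarrow> 'a measure) bC bE vC vE cCE beta0 betaE.
        estimator_seq sC2 sE2 M bC bE vC vE cCE beta0 betaE \<longrightarrow>
        (\<forall>n\<ge>1. beta0 n = betaE n) \<longrightarrow>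
        (\<exists>(P :: (real^2) measure) U0.
           prob_space P \<and> U0 \<in> borel_measurable P \<and> integrable P (\<lambda>x. (U0 x)\<^sup>2) \<and>
           weak_conv_m (mse_error_law M bC bE vC vE cCE beta0) (distr P borel U0) \<and>
           prob_space.expectation P U0 = 0 \<and>
           prob_space.variance P U0 \<in> {sE2 <..< sC2}))
     \<and>
     (\<forall>(M :: real \<Rightarrow> nat \<Rightarrow> 'a measure) bC bE vC vE cCE beta0 betaE.
        (\<forall>h. estimator_seq sC2 sE2 (M h) (bC h) (bE h) (vC h) (vE h) (cCE h) (beta0 h) (betaE h)) \<longrightarrow>
        (\<forall>h. \<forall>n\<ge>1. betaE h n = beta0 h n + h / sqrt (real n)) \<longrightarrow>
        (\<exists>(P :: (real^2) measure) (U :: real \<Rightarrow> real^2 \<Rightarrow> real).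
           prob_space P \<and>
           (\<forall>h. U h \<in> borel_measurable P \<and> integrable P (\<lambda>x. (U h x)\<^sup>2)) \<and>
           (\<forall>h. weak_conv_m (mse_error_law (M h) (bC h) (bE h) (vC h) (vE h) (cCE h) (beta0 h))
                  (distr P borel (U h))) \<and>
           (\<exists>h1 h2.
              (\<forall>h. prob_space.expectation P (\<lambda>x. (U h x)\<^sup>2) - sC2
                     \<le> prob_space.expectation P (\<lambda>x. (U h1 x)\<^sup>2) - sC2) \<and>
              (\<forall>h. sC2 - prob_space.expectation P (\<lambda>x. (U h x)\<^sup>2)
                     \<le> sC2 - prob_space.expectation P (\<lambda>x. (U h2 x)\<^sup>2)) \<and>
              prob_space.expectation P (\<lambda>x. (U h1 x)\<^sup>2) - sC2
                < sC2 - prob_space.expectation P (\<lambda>x. (U h2 x)\<^sup>2))))"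
proof -
  note v = assms
  define t where "t = sqrt (sC2 - sE2)"
  have t: "0 < t" and t2: "t\<^sup>2 + (sqrt sE2)\<^sup>2 = sC2" using v unfolding t_def by auto
  have e2: "(sqrt sE2)\<^sup>2 = sE2" using v by simp
  have part1: "weak_conv_m (mse_error_law M bC bE vC vE cCE (\<lambda>n. b0)) (density lborel (normal_density 0 (sqrt sC2)))"
    if "estimator_seq sC2 sE2 M bC bE vC vE cCE (\<lambda>n. b0) (\<lambda>n. bE0)" "b0 \<noteq> bE0"
    for M :: "nat \<Rightarrow> 'a measure" and bC bE vC vE cCE and b0 bE0 :: real
    by (rule mse_error_law_weak_conv_fixed[OF v that])
  have part2: "\<exists>(P :: (real^2) measure) U0.
           prob_space P \<and> U0 \<in> borel_measurable P \<and> integrable P (\<lambda>x. (U0 x)\<^sup>2) \<and>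
           weak_conv_m (mse_error_law M bC bE vC vE cCE beta0) (distr P borel U0) \<and>
           prob_space.expectation P U0 = 0 \<and>
           prob_space.variance P U0 \<in> {sE2 <..< sC2}"
    if E: "estimator_seq sC2 sE2 M bC bE vC vE cCE beta0 betaE" and eq: "\<forall>n\<ge>1. beta0 n = betaE n"
    for M :: "nat \<Rightarrow> 'a measure" and bC bE vC vE cCE beta0 betaE
  proof -
    obtain N :: "(real^2) measure" where N: "normal_law 0 (vector [vector [sC2, sE2], vector [sE2, sE2]]) N"
      using E unfolding estimator_seq_def by blast
    interpret normal_pair N "\<lambda>x. x $ 1 - x $ 2" "\<lambda>x. x $ 2" t "sqrt sE2"
      unfolding t_def by (rule normal_pair_of_normal_law[OF v N])
    \<comment> \<open>Equal parameters are the local case h = 0.\<close>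
    have h: "\<forall>n\<ge>1. betaE n = beta0 n + 0 / sqrt (real n)" using eq by simp
    show ?thesis
    proof (intro exI conjI)
      show "weak_conv_m (mse_error_law M bC bE vC vE cCE beta0) (distr N borel (mse_limit 0))"
        using mse_error_law_weak_conv_local[OF v E h N] unfolding t_def .
      show "variance (mse_limit 0) \<in> {sE2 <..< sC2}"
        using mse_limit_0_variance unfolding e2 t2[unfolded e2] .
    qed (rule prob_space_axioms mse_limit_measurable mse_limit_second_moment(1) mse_limit_0_mean)+
  qed
  have part3: "\<exists>(P :: (real^2) measure) (U :: real \<Rightarrow> real^2 \<Rightarrow> real).
           prob_space P \<and>
           (\<forall>h. U h \<in> borel_measurable P \<and> integrable P (\<lambda>x. (U h x)\<^sup>2)) \<and>
           (\<forall>h. weak_conv_m (mse_error_law (M h) (bC h) (bE h) (vC h) (vE h) (cCE h) (beta0 h))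
                  (distr P borel (U h))) \<and>
           (\<exists>h1 h2.
              (\<forall>h. prob_space.expectation P (\<lambda>x. (U h x)\<^sup>2) - sC2
                     \<le> prob_space.expectation P (\<lambda>x. (U h1 x)\<^sup>2) - sC2) \<and>
              (\<forall>h. sC2 - prob_space.expectation P (\<lambda>x. (U h x)\<^sup>2)
                     \<le> sC2 - prob_space.expectation P (\<lambda>x. (U h2 x)\<^sup>2)) \<and>
              prob_space.expectation P (\<lambda>x. (U h1 x)\<^sup>2) - sC2
                < sC2 - prob_space.expectation P (\<lambda>x. (U h2 x)\<^sup>2))"
    if E: "\<forall>h. estimator_seq sC2 sE2 (M h) (bC h) (bE h) (vC h) (vE h) (cCE h) (beta0 h) (betaE h)"
      and eq: "\<forall>h. \<forall>n\<ge>1. betaE h n = beta0 h n + h / sqrt (real n)"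
    for M :: "real \<Rightarrow> nat \<Rightarrow> 'a measure" and bC bE vC vE cCE beta0 betaE
  proof -
    \<comment> \<open>A witness from any one h serves for all h, since the local limit theorem
      accepts every measure with this normal law.\<close>
    obtain N :: "(real^2) measure" where N: "normal_law 0 (vector [vector [sC2, sE2], vector [sE2, sE2]]) N"
      using E unfolding estimator_seq_def by blast
    interpret normal_pair N "\<lambda>x. x $ 1 - x $ 2" "\<lambda>x. x $ 2" t "sqrt sE2"
      unfolding t_def by (rule normal_pair_of_normal_law[OF v N])
    obtain k1 where k1: "\<forall>k. mean_excess_risk k \<le> mean_excess_risk k1" using mean_excess_risk_has_max by (rule exE)
    obtain k2 where k2: "\<forall>k. mean_excess_risk k2 \<le> mean_excess_risk k" using mean_excess_risk_has_min by (rule exE)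
    have mom: "expectation (\<lambda>x. (mse_limit h x)\<^sup>2) = sC2 + t\<^sup>2 * mean_excess_risk (h / t)" for h
      using mse_limit_second_moment(2)[of h] unfolding t2 .
    have hk: "t * k / t = k" for k using t by simp
    show ?thesis
    proof (rule exI[of _ N], rule exI[of _ mse_limit], intro conjI allI, goal_cases)
      case (4 h)
      show ?case using mse_error_law_weak_conv_local[OF v spec[OF E] spec[OF eq] N, of h] unfolding t_def .
    next
      case 5
      \<comment> \<open>The excess over \<open>sC2\<close> depends on h through h / t, so the
        extremal h are t * k1 and t * k2; the largest gain is at the minimiser
        \<open>k2\<close>.\<close>
      have "t\<^sup>2 * mean_excess_risk k1 < t\<^sup>2 * (- mean_excess_risk k2)"
        by (rule mult_strict_left_mono[OF mean_excess_risk_max_less[OF k2]]) (use t in simp)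
      moreover have "t\<^sup>2 * mean_excess_risk (h / t) \<le> t\<^sup>2 * mean_excess_risk k1"
          "t\<^sup>2 * mean_excess_risk k2 \<le> t\<^sup>2 * mean_excess_risk (h / t)" for h
        using k1 k2 by (auto intro: mult_left_mono)
      ultimately show ?case
        unfolding mom by - (rule exI[of _ "t * k1"], rule exI[of _ "t * k2"], simp add: hk)
    qed (rule prob_space_axioms mse_limit_measurable mse_limit_second_moment(1))+
  qed
  show ?thesis
    by (intro conjI allI impI) (rule part1 part2 part3, assumption+)+
qed

end
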